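(* Consider the first-order dynamics $$\begin{cases}\dot\phi_{\mathrm I}(t)=-iH_{\mathrm I,\mathrm I}\,\phi_{\mathrm I}(t)-iE^{T}f_\Gamma(t),\\[2pt] \dot f_\Gamma(t)=B f_\Gamma(t)+AE\,\phi_{\mathrm I}(t),\end{cases}\qquad (\phi_{\mathrm I}(t),f_\Gamma(t))\in\mathbb C^{n_{\mathrm I}}\times\mathbb C^{n_\Gamma},$$ with $n_\Gamma\times n_\Gamma$ coefficient matrices $A,B$, corresponding to the rational function $R_{1,1}(s)=(sI-B)^{-1}A$. This dynamics is stable if the coefficients $A$ and $B$ are determined by the interpolations $$\lim_{\lambda\to0}\frac{d}{d\lambda}R_{1,1}=\lim_{\lambda\to0}\frac{d}{d\lambda}K,\quad\text{where }\lambda=s^{-1},\qquad\text{and}\qquad R_{1,1}(s_1)=K(s_1),$$ where $s_1$ is any positive real number and $$K(s)=-H_{\Gamma,\mathrm{II}}\,\big(H_{\mathrm{II},\mathrm{II}}-isI\big)^{-1}H_{\mathrm{II},\Gamma}.$$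
   Context: Setting. A time-dependent Schrödinger equation $i\partial_t\phi=\hat H\phi$, $\hat H=-\frac{\nabla^2}{2}+V$, on $\Omega=\Omega_{\mathrm I}\cup\Omega_{\mathrm{II}}\subset\mathbb R^d$, with $V$ zero (or constant) in the exterior $\Omega_{\mathrm{II}}$, is discretized in space by finite differences on a uniform grid with $n_{\mathrm I}$ points in the interior $\Omega_{\mathrm I}$ and $n_{\mathrm{II}}$ points in $\Omega_{\mathrm{II}}$ ($n_{\mathrm{II}}$ can be infinite). The discretized Hamiltonian is Hermitian with block form $$H=\begin{bmatrix}H_{\mathrm I,\mathrm I}&H_{\mathrm I,\mathrm{II}}\\ H_{\mathrm{II},\mathrm I}&H_{\mathrm{II},\mathrm{II}}\end{bmatrix},$$ so that the semi-discrete model is $i\dot\phi_{\mathrm I}=H_{\mathrm I,\mathrm I}\phi_{\mathrm I}+H_{\mathrm I,\mathrm{II}}\phi_{\mathrm{II}}$, $i\dot\phi_{\mathrm{II}}=H_{\mathrm{II},\mathrm I}\phi_{\mathrm I}+H_{\mathrm{II},\mathrm{II}}\phi_{\mathrm{II}}$, with $\phi_{\mathrm{II}}(0)=0$. The block $H_{\mathrm I,\mathrm I}$ can be a nonlinear operator. Boundary set. $\Gamma\subset\Omega_{\mathrm I}$ is the set of interior grid points $x_j$ for which there is an exterior grid point $x_k\in\Omega_{\mathrm{II}}$ with $H_{jk}\neq0$; $n_\Gamma$ is the number of its points. The points of $\Omega_{\mathrm I}$ are ordered so that those of $\Gamma$ come first, and $E=[\,I_{n_\Gamma}\;\;0\,]\in\mathbb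 R^{n_\Gamma\times n_{\mathrm I}}$ is the restriction to $\Gamma$. Then $H_{\mathrm{II},\Gamma}=H_{\mathrm{II},\mathrm I}E^T$ and $H_{\mathrm I,\mathrm{II}}=E^TH_{\Gamma,\mathrm{II}}$. The function $K(s)$ is the discrete Dirichlet-to-Neumann map in the Laplace domain: the Laplace transforms of $f_\Gamma=H_{\Gamma,\mathrm{II}}\phi_{\mathrm{II}}$ and $\phi_\Gamma=E\phi_{\mathrm I}$ satisfy $F_\Gamma(s)=K(s)\Phi_\Gamma(s)$. The first-order approximation replaces $K(s)$ by $R_{1,1}(s)$. In the first interpolation condition, $R_{1,1}$ and $K$ are regarded as functions of $\lambda=s^{-1}$. Stability is understood in the sense of Lyapunov, for the zero solution of the system.
   Formalization: "Determined by the interpolations" is taken to mean that (A,B) is the only pair satisfying both conditions with s_1 I-B invertible (i.e. H_{Γ,II}H_{II,Γ} is invertible); otherwise B is partly arbitrary and the dynamics can be unstable. *)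

theory Defs
  imports "HOL-Analysis.Analysis"
begin

text \<open>
  Interior grid points are indexed by a finite type \<open>'i\<close>, exterior grid points by an
  arbitrary type \<open>'e\<close>, finite or infinite; exterior grid functions live in the Hilbert space
  \<open>\<ell>\<^sup>2('e)\<close>, which for finite \<open>'e\<close> consists of all functions.
\<close>

definition ell2 :: "('e \<Rightarrow> complex) set" where
  "ell2 = {x. (\<lambda>k. (cmod (x k))\<^sup>2) summable_on UNIV}"

definition ell2_norm :: "('e \<Rightarrow> complex) \<Rightarrow> real" where
  "ell2_norm x = sqrt (\<Sum>\<^sub>\<infinity>k. (cmod (x k))\<^sup>2)"

definition op_apply :: "('e \<Rightarrow> 'e \<Rightarrow> complex) \<Rightarrow> ('e \<Rightarrow> complex) \<Rightarrow> 'e \<Rightarrow> complex" where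
  "op_apply M x = (\<lambda>j. \<Sum>\<^sub>\<infinity>k. M j k * x k)"

text \<open>
  The matrix \<open>M\<close> is a bounded operator on \<open>\<ell>\<^sup>2('e)\<close>. This is automatic for finite \<open>'e\<close>, and it
  holds for finite differences on an infinite uniform grid with constant potential, where the
  entries are bounded and the number of nonzero entries per row and column is bounded.
\<close>

definition bounded_on_ell2 :: "('e \<Rightarrow> 'e \<Rightarrow> complex) \<Rightarrow> bool" where
  "bounded_on_ell2 M \<longleftrightarrow>
     (\<forall>x\<in>ell2. \<forall>j. (\<lambda>k. M j k * x k) summable_on UNIV) \<and>
     (\<exists>C. \<forall>x\<in>ell2. op_apply M x \<in> ell2 \<and> ell2_norm (op_apply M x) \<le> C * ell2_norm x)"

text \<open>\<open>(M - z I)\<^sup>-\<^sup>1 v\<close> on \<open>\<ell>\<^sup>2('e)\<close>; meaningful only for \<open>z\<close> in the resolvent set of \<open>M\<close>.\<close>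

definition resolvent_apply ::
    "('e \<Rightarrow> 'e \<Rightarrow> complex) \<Rightarrow> complex \<Rightarrow> ('e \<Rightarrow> complex) \<Rightarrow> 'e \<Rightarrow> complex" where
  "resolvent_apply M z v = (THE x. x \<in> ell2 \<and> (\<forall>j. op_apply M x j - z * x j = v j))"

text \<open>
  The blocks are \<open>HII\<close>, \<open>HIE\<close>, \<open>HEI\<close>, \<open>HEE\<close> (\<open>I\<close> interior, \<open>E\<close> exterior). To allow a nonlinear
  interior block, \<open>HII \<phi>\<close> is a matrix that may depend on the state \<open>\<phi>\<close>, and the operator is
  \<open>\<phi> \<mapsto> HII \<phi> *v \<phi>\<close>; the linear case is that of a constant \<open>HII\<close>. The
  operators of this form with Hermitian \<open>HII \<phi>\<close> are exactly the maps \<open>N\<close> with \<open>N 0 = 0\<close> and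
  \<open>\<langle>\<phi>, N \<phi>\<rangle>\<close> real for all \<open>\<phi>\<close>.
\<close>

definition hermitian_blocks ::
    "(complex^'i \<Rightarrow> complex^'i^'i) \<Rightarrow> ('i \<Rightarrow> 'e \<Rightarrow> complex) \<Rightarrow>
     ('e \<Rightarrow> 'i \<Rightarrow> complex) \<Rightarrow> ('e \<Rightarrow> 'e \<Rightarrow> complex) \<Rightarrow> bool" where
  "hermitian_blocks HII HIE HEI HEE \<longleftrightarrow>
     (\<forall>\<phi> j k. HII \<phi> $ j $ k = cnj (HII \<phi> $ k $ j)) \<and>
     (\<forall>j k. HIE j k = cnj (HEI k j)) \<and>
     (\<forall>j k. HEE j k = cnj (HEE k j))"

definition boundary_set :: "('i \<Rightarrow> 'e \<Rightarrow> complex) \<Rightarrow> 'i set" where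
  "boundary_set HIE = {j. \<exists>k. HIE j k \<noteq> 0}"

text \<open>
  The boundary set is enumerated by a bijection \<open>\<iota>\<close> from an index type \<open>'g\<close> onto it, so that
  \<open>CARD('g)\<close> is the number of its points; this replaces the convention that these points
  come first among the interior ones.
\<close>

definition restriction :: "('g \<Rightarrow> 'i) \<Rightarrow> complex^'i^'g" where
  "restriction \<iota> = (\<chi> a j. if j = \<iota> a then 1 else 0)"

definition DtN ::
    "('g \<Rightarrow> 'i) \<Rightarrow> ('i \<Rightarrow> 'e \<Rightarrow> complex) \<Rightarrow> ('e \<Rightarrow> 'i \<Rightarrow> complex) \<Rightarrow>
     ('e \<Rightarrow> 'e \<Rightarrow> complex) \<Rightarrow> complex \<Rightarrow> complex^'g^'g" where
  "DtN \<iota> HIE HEI HEE s =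
     (\<chi> a b. - (\<Sum>\<^sub>\<infinity>k. HIE (\<iota> a) k * resolvent_apply HEE (\<i> * s) (\<lambda>l. HEI l (\<iota> b)) k))"

definition R11 :: "complex^'g^'g \<Rightarrow> complex^'g^'g \<Rightarrow> complex \<Rightarrow> complex^'g^'g" where
  "R11 A B s = matrix_inv (mat s - B) ** A"

definition matrix_deriv :: "(complex \<Rightarrow> complex^'m^'n) \<Rightarrow> complex \<Rightarrow> complex^'m^'n" where
  "matrix_deriv F z = (\<chi> i j. deriv (\<lambda>w. F w $ i $ j) z)"

definition interpolates ::
    "(complex \<Rightarrow> complex^'g^'g) \<Rightarrow> real \<Rightarrow> complex^'g^'g \<Rightarrow> complex^'g^'g \<Rightarrow> bool" where
  "interpolates K s\<^sub>1 A B \<longleftrightarrow>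
     (\<exists>L. (matrix_deriv (\<lambda>z. R11 A B (inverse z)) \<longlongrightarrow> L) (at 0) \<and>
          (matrix_deriv (\<lambda>z. K (inverse z)) \<longlongrightarrow> L) (at 0)) \<and>
     invertible (mat (of_real s\<^sub>1) - B) \<and>
     R11 A B (of_real s\<^sub>1) = K (of_real s\<^sub>1)"

text \<open>
  "Determined" means that \<open>(A, B)\<close> is the only solution of the interpolation conditions.
  Solving them alone would not do: if \<open>H\<^bsub>\<Gamma>,II\<^esub> H\<^bsub>II,\<Gamma>\<^esub>\<close> is singular, they leave \<open>B\<close> free on a
  complement of the range of \<open>A\<close>, where it may have eigenvalues with positive real part.
\<close>

definition determined_by_interpolation ::
    "(complex \<Rightarrow> complex^'g^'g) \<Rightarrow> real \<Rightarrow> complex^'g^'g \<Rightarrow> complex^'g^'g \<Rightarrow> bool" where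
  "determined_by_interpolation K s\<^sub>1 A B \<longleftrightarrow>
     interpolates K s\<^sub>1 A B \<and> (\<forall>A' B'. interpolates K s\<^sub>1 A' B' \<longrightarrow> A' = A \<and> B' = B)"

definition first_order_dynamics ::
    "(complex^'i \<Rightarrow> complex^'i^'i) \<Rightarrow> complex^'i^'g \<Rightarrow> complex^'g^'g \<Rightarrow> complex^'g^'g \<Rightarrow>
     (complex^'i) \<times> (complex^'g) \<Rightarrow> (complex^'i) \<times> (complex^'g)" where
  "first_order_dynamics HII E A B = (\<lambda>(\<phi>, f).
     (- (\<i> *s (HII \<phi> *v \<phi>)) - \<i> *s (transpose E *v f),
      B *v f + A *v (E *v \<phi>)))"

definition solves_ode :: "('a::real_normed_vector \<Rightarrow> 'a) \<Rightarrow> real \<Rightarrow> (real \<Rightarrow> 'a) \<Rightarrow> bool" where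
  "solves_ode F T x \<longleftrightarrow> (\<forall>t\<in>{0..<T}. (x has_vector_derivative F (x t)) (at t within {0..<T}))"

text \<open>
  Solutions on every interval \<open>[0, T)\<close> are considered, so the bound also covers solutions on
  \<open>[0, \<infinity>)\<close> and rules out finite-time blow-up.
\<close>

definition lyapunov_stable_zero :: "('a::real_normed_vector \<Rightarrow> 'a) \<Rightarrow> bool" where
  "lyapunov_stable_zero F \<longleftrightarrow> F 0 = 0 \<and>
     (\<forall>\<epsilon>>0. \<exists>\<delta>>0. \<forall>T x. solves_ode F T x \<and> norm (x 0) < \<delta> \<longrightarrow>
        (\<forall>t\<in>{0..<T}. norm (x t) < \<epsilon>))"

end

theory Submission
  imports Defs "HOL-Complex_Analysis.Cauchy_Integral_Formula"
begin

text \<open>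
  Write \<open>M = H\<^bsub>II,II\<^esub>\<close>, \<open>v\<^sub>a\<close> for the columns of \<open>H\<^bsub>II,\<Gamma>\<^esub>\<close>, \<open>X\<^sub>a = (M - \<i>s\<^sub>1)\<^sup>-\<^sup>1v\<^sub>a\<close>, and \<open>P\<close>, \<open>Z\<close> for the
  matrices of the inner products \<open>\<langle>v\<^sub>a, v\<^sub>b\<rangle>\<close>, \<open>\<langle>v\<^sub>a, X\<^sub>b\<rangle>\<close>. The condition at \<open>\<lambda> = 0\<close> gives \<open>A = -\<i>P\<close>, the one
  at \<open>s\<^sub>1\<close> gives \<open>(s\<^sub>1 - B) Z = \<i>P\<close>. If \<open>Z\<close> were singular, \<open>B\<close> would not be unique, so \<open>P\<close> and \<open>Z\<close>
  are invertible. The Lyapunov function is \<open>\<parallel>\<phi>\<parallel>\<^sup>2 + \<langle>f, P\<^sup>-\<^sup>1f\<rangle>\<close>. The coupling terms cancel in its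
  derivative. Since \<open>P\<close> is a Gram matrix, \<open>\<langle>f, P\<^sup>-\<^sup>1f\<rangle> = \<parallel>u\<parallel>\<^sup>2\<close> for the combination \<open>u\<close> of the \<open>v\<^sub>a\<close> with
  coefficients \<open>P\<^sup>-\<^sup>1f\<close>; this \<open>u\<close> is the orthogonal projection of \<open>x = \<Sum> (Z\<^sup>-\<^sup>1f)\<^sub>a X\<^sub>a\<close> onto the span
  of the \<open>v\<^sub>a\<close>, and the derivative equals \<open>2s\<^sub>1(\<parallel>u\<parallel>\<^sup>2 - \<parallel>x\<parallel>\<^sup>2) \<le> 0\<close>.
\<close>

section \<open>The Hilbert space \<open>\<ell>\<^sup>2\<close>\<close>

lemma ell2_add:
  assumes "x \<in> ell2" "y \<in> ell2"
  shows "(\<lambda>k. x k + y k) \<in> ell2"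
proof -
  have "(\<lambda>k. 2 * (cmod (x k))\<^sup>2 + 2 * (cmod (y k))\<^sup>2) summable_on UNIV"
    using assms by (intro summable_on_add summable_on_cmult_right) (auto simp: ell2_def)
  moreover have "(cmod (x k + y k))\<^sup>2 \<le> 2 * (cmod (x k))\<^sup>2 + 2 * (cmod (y k))\<^sup>2" for k
  proof -
    have "(cmod (x k + y k))\<^sup>2 \<le> (cmod (x k) + cmod (y k))\<^sup>2"
      by (intro power_mono norm_triangle_ineq) auto
    also have "\<dots> \<le> 2 * (cmod (x k))\<^sup>2 + 2 * (cmod (y k))\<^sup>2"
      using sum_squares_ge_zero[of "cmod (x k) - cmod (y k)" 0]
      by (simp add: power2_eq_square algebra_simps)
    finally show ?thesis .
  qed
  ultimately show ?thesis
    unfolding ell2_def mem_Collect_eq by (rule summable_on_comparison_test) auto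
qed

lemma ell2_cmult: "x \<in> ell2 \<Longrightarrow> (\<lambda>k. c * x k) \<in> ell2"
  unfolding ell2_def by (simp add: norm_mult power_mult_distrib summable_on_cmult_right)

lemma ell2_cnj: "x \<in> ell2 \<Longrightarrow> (\<lambda>k. cnj (x k)) \<in> ell2"
  by (simp add: ell2_def)

lemma ell2_mult_summable:
  assumes "x \<in> ell2" "y \<in> ell2"
  shows "(\<lambda>k. x k * y k) summable_on UNIV"
proof -
  have "(\<lambda>k. (cmod (x k))\<^sup>2 + (cmod (y k))\<^sup>2) summable_on UNIV"
    using assms by (intro summable_on_add) (auto simp: ell2_def)
  moreover have "norm (x k * y k) \<le> (cmod (x k))\<^sup>2 + (cmod (y k))\<^sup>2" for k
  proof -
    \<comment> \<open>The right-hand side is twice the gap in the claimed inequality.\<close>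
    have "0 \<le> (cmod (x k) - cmod (y k))\<^sup>2 + (cmod (x k))\<^sup>2 + (cmod (y k))\<^sup>2"
      by (intro add_nonneg_nonneg) auto
    then show ?thesis
      by (simp add: norm_mult power2_eq_square algebra_simps)
  qed
  ultimately have "(\<lambda>k. norm (x k * y k)) summable_on UNIV"
    by (rule summable_on_comparison_test) auto
  then show ?thesis
    by (rule abs_summable_summable)
qed

section \<open>Square-summable functions as a complete complex inner product space\<close>

typedef 'e l2 = "ell2 :: ('e \<Rightarrow> complex) set" morphisms coord Abs_l2
  by (rule exI[of _ "\<lambda>_. 0"]) (simp add: ell2_def)

lemma coord_ell2 [simp]: "coord x \<in> ell2"
  by (rule coord)

lemma l2_eqI: "(\<And>k. coord x k = coord y k) \<Longrightarrow> x = y"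
  by (auto simp: coord_inject[symmetric])

text \<open>Complex scalars act through this function; the \<open>scaleR\<close> of the class
  instance is its restriction to real scalars.\<close>

definition scaleC :: "complex \<Rightarrow> 'e l2 \<Rightarrow> 'e l2" where
  "scaleC c x = Abs_l2 (\<lambda>k. c * coord x k)"

text \<open>The complex inner product, conjugate-linear in the first argument. Its real part serves
  as \<open>inner\<close>, so the theory of real inner product spaces applies.\<close>

definition cip :: "'e l2 \<Rightarrow> 'e l2 \<Rightarrow> complex" where
  "cip x y = (\<Sum>\<^sub>\<infinity>k. cnj (coord x k) * coord y k)"

lemma coord_scaleC [simp]: "coord (scaleC c x) k = c * coord x k"
  by (simp add: scaleC_def Abs_l2_inverse ell2_cmult)

lemma cip_summable: "(\<lambda>k. cnj (coord x k) * coord y k) summable_on UNIV"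
  by (intro ell2_mult_summable ell2_cnj) simp_all

instantiation l2 :: (type) real_vector
begin

definition "0 = Abs_l2 (\<lambda>k::'a. 0)"
definition "x + y = Abs_l2 (\<lambda>k::'a. coord x k + coord y k)"
definition "- x = scaleC (-1) (x :: 'a l2)"
definition "x - y = x + (- y :: 'a l2)"
definition "r *\<^sub>R x = scaleC (of_real r) (x :: 'a l2)"
instance
proof
  fix x y z :: "'a l2" and a b r :: real
  have c0: "coord (0 :: 'a l2) k = 0" for k
    by (simp add: zero_l2_def Abs_l2_inverse ell2_def)
  have cp: "coord (x + y) k = coord x k + coord y k" for x y :: "'a l2" and k
    by (simp add: plus_l2_def Abs_l2_inverse ell2_add)
  note c = c0 cp uminus_l2_def minus_l2_def scaleR_l2_def
  show "x + y + z = x + (y + z)" "x + y = y + x" "0 + x = x" "- x + x = 0" "x - y = x + - y"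
    "a *\<^sub>R (x + y) = a *\<^sub>R x + a *\<^sub>R y" "(a + b) *\<^sub>R x = a *\<^sub>R x + b *\<^sub>R x"
    "a *\<^sub>R b *\<^sub>R x = (a * b) *\<^sub>R x" "1 *\<^sub>R x = x"
    by (auto intro!: l2_eqI simp: c algebra_simps)
qed

end

lemma coord_0 [simp]: "coord 0 k = 0"
  by (simp add: zero_l2_def Abs_l2_inverse ell2_def)

lemma coord_add [simp]: "coord (x + y) k = coord x k + coord y k"
  by (simp add: plus_l2_def Abs_l2_inverse ell2_add)

lemma coord_uminus [simp]: "coord (- x) k = - coord x k"
  by (simp add: uminus_l2_def)

lemma coord_diff [simp]: "coord (x - y) k = coord x k - coord y k"
  unfolding minus_l2_def coord_add coord_uminus by simp

lemma scaleR_scaleC: "r *\<^sub>R x = scaleC (of_real r) (x :: 'e l2)"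
  by (rule scaleR_l2_def)

lemma coord_sum [simp]: "coord (\<Sum>a\<in>S. f a) k = (\<Sum>a\<in>S. coord (f a) k)"
  by (induction S rule: infinite_finite_induct) auto

lemma scaleC_simps:
  "scaleC c (x + y) = scaleC c x + scaleC c y"
  "scaleC c (x - y) = scaleC c x - scaleC c y"
  "scaleC c (- x) = - scaleC c x"
  "scaleC (c + d) x = scaleC c x + scaleC d x"
  "scaleC (c - d) x = scaleC c x - scaleC d x"
  "scaleC (- c) x = - scaleC c x"
  "scaleC c (scaleC d x) = scaleC (c * d) x"
  "scaleC 1 x = x" "scaleC 0 x = 0" "scaleC c 0 = 0"
  by (auto intro!: l2_eqI simp: algebra_simps)

lemma cip_add_left: "cip (x + y) z = cip x z + cip y z"
  by (simp add: cip_def distrib_right infsum_add cip_summable)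

lemma cip_scaleC_left: "cip (scaleC c x) y = cnj c * cip x y"
  by (simp add: cip_def mult.assoc infsum_cmult_right')

lemma cip_commute: "cip x y = cnj (cip y x)"
  unfolding cip_def infsum_cnj[symmetric] by (simp add: mult.commute)

lemma cip_add_right: "cip x (y + z) = cip x y + cip x z"
  by (simp add: cip_def distrib_left infsum_add cip_summable)

lemma cip_scaleC_right: "cip x (scaleC c y) = c * cip x y"
  by (simp add: cip_def mult.left_commute[of _ c] infsum_cmult_right')

lemma cip_diff_left: "cip (x - y) z = cip x z - cip y z"
  using cip_add_left[of "x - y" y z] by simp

lemma cip_diff_right: "cip x (y - z) = cip x y - cip x z"
  using cip_add_right[of x "y - z" z] by simp

lemma cip_zero [simp]: "cip 0 x = 0" "cip x 0 = 0"
  by (simp_all add: cip_def)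

lemma cip_sum_left: "cip (\<Sum>a\<in>S. f a) y = (\<Sum>a\<in>S. cip (f a) y)"
  by (induction S rule: infinite_finite_induct) (auto simp: cip_add_left)

lemma cip_sum_right: "cip x (\<Sum>a\<in>S. f a) = (\<Sum>a\<in>S. cip x (f a))"
  by (induction S rule: infinite_finite_induct) (auto simp: cip_add_right)

lemma coord_summable: "(\<lambda>k. (cmod (coord x k))\<^sup>2) summable_on UNIV"
  using coord_ell2[of x] unfolding ell2_def by blast

lemma cip_self_infsum: "cip x x = of_real (\<Sum>\<^sub>\<infinity>k. (cmod (coord x k))\<^sup>2)"
proof -
  have "cip x x = (\<Sum>\<^sub>\<infinity>k. of_real ((cmod (coord x k))\<^sup>2))"
    unfolding cip_def by (intro infsum_cong) (metis complex_norm_square mult.commute)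
  also have "\<dots> = of_real (\<Sum>\<^sub>\<infinity>k. (cmod (coord x k))\<^sup>2)"
    by (intro infsumI has_sum_of_real has_sum_infsum coord_summable)
  finally show ?thesis .
qed

instantiation l2 :: (type) real_inner
begin

definition "inner x y = Re (cip x (y :: 'a l2))"
definition "norm x = sqrt (inner x (x :: 'a l2))"
definition "dist x y = norm (x - y :: 'a l2)"
definition "sgn x = inverse (norm x) *\<^sub>R (x :: 'a l2)"
definition [code del]:
  "(uniformity :: ('a l2 \<times> 'a l2) filter) = (INF e\<in>{0<..}. principal {(x, y). dist x y < e})"
definition [code del]:
  "open (U :: 'a l2 set) = (\<forall>x\<in>U. eventually (\<lambda>(x', y). x' = x \<longrightarrow> y \<in> U) uniformity)"

instance
proof
  fix x y z :: "'a l2" and a b r :: real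
  show "dist x y = norm (x - y)" "sgn x = x /\<^sub>R norm x"
    by (simp_all add: dist_l2_def sgn_l2_def)
  show "uniformity = (INF e\<in>{0<..}. principal {(x::'a l2, y). dist x y < e})"
    by (rule uniformity_l2_def)
  show "open U = (\<forall>x\<in>U. \<forall>\<^sub>F (x', y) in uniformity. x' = x \<longrightarrow> y \<in> U)" for U :: "'a l2 set"
    by (rule open_l2_def)
  show "inner x y = inner y x"
    by (metis inner_l2_def cip_commute cnj.simps(1))
  show "inner (x + y) z = inner x z + inner y z"
    by (simp add: inner_l2_def cip_add_left)
  show "inner (r *\<^sub>R x) y = r * inner x y"
    by (simp add: inner_l2_def scaleR_scaleC cip_scaleC_left)
  have nn: "inner x x = (\<Sum>\<^sub>\<infinity>k. (cmod (coord x k))\<^sup>2)"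
    by (simp add: inner_l2_def cip_self_infsum)
  show "0 \<le> inner x x"
    unfolding nn by (rule infsum_nonneg) simp
  show "inner x x = 0 \<longleftrightarrow> x = 0"
  proof
    assume "inner x x = 0"
    then have z: "(\<Sum>\<^sub>\<infinity>k. (cmod (coord x k))\<^sup>2) = 0" using nn by simp
    have "(cmod (coord x k))\<^sup>2 \<le> 0" for k
      using finite_sum_le_infsum[OF coord_summable, of "{k}" x] z by simp
    then show "x = 0" by (intro l2_eqI) simp
  next
    assume "x = 0"
    then have "coord x k = 0" for k by simp
    then show "inner x x = 0" by (simp add: nn)
  qed
  show "norm x = sqrt (inner x x)"
    by (rule norm_l2_def)
qed

end

lemma inner_l2: "inner x y = Re (cip x y)"
  by (rule inner_l2_def)

lemma cip_self: "cip x x = of_real ((norm x)\<^sup>2)"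
proof -
  have "Im (cip x x) = 0"
    using cip_commute[of x x] by (metis cnj.simps(2) equal_neg_zero)
  moreover have "Re (cip x x) = (norm x)\<^sup>2"
    by (simp add: inner_l2[symmetric] power2_norm_eq_inner)
  ultimately show ?thesis by (simp add: complex_eq_iff)
qed

lemma norm_scaleC [simp]: "norm (scaleC c x) = cmod c * norm x"
proof -
  have "cip (scaleC c x) (scaleC c x) = of_real ((cmod c)\<^sup>2) * cip x x"
    unfolding cip_scaleC_left cip_scaleC_right complex_norm_square by (simp only: mult_ac)
  then have "complex_of_real ((norm (scaleC c x))\<^sup>2) = of_real ((cmod c * norm x)\<^sup>2)"
    by (simp add: cip_self power_mult_distrib)
  then have "(norm (scaleC c x))\<^sup>2 = (cmod c * norm x)\<^sup>2"
    by (rule of_real_eq_iff[THEN iffD1])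
  then show ?thesis by (simp add: power2_eq_iff_nonneg)
qed

text \<open>Rotating \<open>x\<close> by the phase of \<open>cip x y\<close> makes the product real
  and non-negative, which reduces the complex Cauchy-Schwarz inequality to the real one.\<close>

lemma norm_cip_le: "cmod (cip x y) \<le> norm x * norm y"
proof (cases "cip x y = 0")
  case False
  define u where "u = cip x y / of_real (cmod (cip x y))"
  have u: "cmod u = 1" using False by (simp add: u_def norm_divide)
  have "cip (scaleC u x) y = of_real (cmod (cip x y))"
    using False complex_norm_square[of "cip x y"]
    by (simp add: u_def cip_scaleC_left field_simps power2_eq_square)
  then have "cmod (cip x y) = inner (scaleC u x) y"
    by (simp add: inner_l2)
  also have "\<dots> \<le> norm (scaleC u x) * norm y"
    by (rule norm_cauchy_schwarz)
  finally show ?thesis by (simp add: u)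
qed simp

lemma norm_l2_square: "(norm x)\<^sup>2 = (\<Sum>\<^sub>\<infinity>k. (cmod (coord x k))\<^sup>2)"
  using cip_self[of x] cip_self_infsum[of x] of_real_eq_iff by metis

lemma norm_l2_eq: "norm x = ell2_norm (coord x)"
  unfolding ell2_norm_def norm_l2_square[symmetric] by simp

lemma sum_coord_le: "finite F \<Longrightarrow> (\<Sum>k\<in>F. (cmod (coord x k))\<^sup>2) \<le> (norm x)\<^sup>2"
  unfolding norm_l2_square by (intro finite_sum_le_infsum coord_summable) auto

lemma coord_le: "cmod (coord x k) \<le> norm x"
  using sum_coord_le[of "{k}" x] by (simp add: power2_le_iff_abs_le)

text \<open>Bounds on finite partial sums survive pointwise limits. This turns them into membership
  and a norm bound, as the completeness proof requires.\<close>

lemma ell2_if_sums_bounded: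
  assumes "\<And>F. finite F \<Longrightarrow> (\<Sum>k\<in>F. (cmod (x k))\<^sup>2) \<le> c\<^sup>2" "c \<ge> 0"
  shows "x \<in> ell2" "norm (Abs_l2 x) \<le> c"
proof -
  have b: "bdd_above (sum (\<lambda>k. (cmod (x k))\<^sup>2) ` {F. F \<subseteq> UNIV \<and> finite F})"
    using assms(1) by (auto intro!: bdd_aboveI2[of _ _ "c\<^sup>2"])
  have s: "(\<lambda>k. (cmod (x k))\<^sup>2) summable_on UNIV"
    using b by (intro nonneg_bdd_above_summable_on) auto
  then show x: "x \<in> ell2" by (simp add: ell2_def)
  have "(norm (Abs_l2 x))\<^sup>2 = (\<Sum>\<^sub>\<infinity>k. (cmod (x k))\<^sup>2)"
    by (simp add: norm_l2_square Abs_l2_inverse x)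
  also have "\<dots> \<le> c\<^sup>2"
    using s assms(1) by (intro infsum_le_finite_sums) auto
  finally show "norm (Abs_l2 x) \<le> c"
    using assms(2) by (rule power2_le_imp_le)
qed

text \<open>A Cauchy sequence converges in each coordinate. Letting \<open>m\<close> tend to
  infinity in finite partial sums for \<open>X m - X n\<close> bounds those for the limit minus
  \<open>X n\<close>. Completeness is what the fixed point argument for resolvents rests on.\<close>

instance l2 :: (type) complete_space
proof
  fix X :: "nat \<Rightarrow> 'a l2"
  assume X: "Cauchy X"
  have "Cauchy (\<lambda>n. coord (X n) k)" for k
  proof (rule metric_CauchyI)
    fix e :: real assume "e > 0"
    then obtain N where "\<forall>m\<ge>N. \<forall>n\<ge>N. dist (X m) (X n) < e"
      using metric_CauchyD[OF X] by blast
    moreover have "dist (coord (X m) k) (coord (X n) k) \<le> dist (X m) (X n)" for m n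
      using coord_le[of "X m - X n" k] by (simp add: dist_norm)
    ultimately show "\<exists>M. \<forall>m\<ge>M. \<forall>n\<ge>M. dist (coord (X m) k) (coord (X n) k) < e"
      by (meson le_less_trans)
  qed
  then have lim: "(\<lambda>n. coord (X n) k) \<longlonglongrightarrow> lim (\<lambda>n. coord (X n) k)" for k
    by (simp add: Cauchy_convergent convergent_LIMSEQ_iff[symmetric])
  define y where "y k = lim (\<lambda>n. coord (X n) k)" for k
  have y: "(\<lambda>n. coord (X n) k) \<longlonglongrightarrow> y k" for k
    using lim by (simp add: y_def)
  have key: "\<exists>N. \<forall>n\<ge>N. (\<lambda>k. y k - coord (X n) k) \<in> ell2 \<and>
      norm (Abs_l2 (\<lambda>k. y k - coord (X n) k)) \<le> e" if e: "e > 0" for e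
  proof -
    obtain N where N: "\<And>m n. m \<ge> N \<Longrightarrow> n \<ge> N \<Longrightarrow> dist (X m) (X n) < e"
      using metric_CauchyD[OF X e] by blast
    have b: "(\<Sum>k\<in>F. (cmod (y k - coord (X n) k))\<^sup>2) \<le> e\<^sup>2" if "finite F" "n \<ge> N" for F n
    proof (rule LIMSEQ_le_const2)
      show "(\<lambda>m. \<Sum>k\<in>F. (cmod (coord (X m) k - coord (X n) k))\<^sup>2)
          \<longlonglongrightarrow> (\<Sum>k\<in>F. (cmod (y k - coord (X n) k))\<^sup>2)"
        by (intro tendsto_intros y)
      show "\<exists>M. \<forall>m\<ge>M. (\<Sum>k\<in>F. (cmod (coord (X m) k - coord (X n) k))\<^sup>2) \<le> e\<^sup>2"
      proof (intro exI allI impI)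
        fix m assume "m \<ge> N"
        have "(\<Sum>k\<in>F. (cmod (coord (X m) k - coord (X n) k))\<^sup>2) \<le> (norm (X m - X n))\<^sup>2"
          using sum_coord_le[OF that(1), of "X m - X n"] by simp
        also have "\<dots> \<le> e\<^sup>2"
          using N[OF \<open>m \<ge> N\<close> that(2)] by (intro power_mono) (auto simp: dist_norm)
        finally show "(\<Sum>k\<in>F. (cmod (coord (X m) k - coord (X n) k))\<^sup>2) \<le> e\<^sup>2" .
      qed
    qed
    show ?thesis
    proof (intro exI[of _ N] allI impI conjI)
      fix n assume "n \<ge> N"
      note * = ell2_if_sums_bounded[of "\<lambda>k. y k - coord (X n) k" e, OF b[OF _ \<open>n \<ge> N\<close>] less_imp_le[OF e]]
      show "(\<lambda>k. y k - coord (X n) k) \<in> ell2" "norm (Abs_l2 (\<lambda>k. y k - coord (X n) k)) \<le> e"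
        by (rule *; assumption)+
    qed
  qed
  obtain N where "(\<lambda>k. y k - coord (X N) k) \<in> ell2"
    using key[of 1] by auto
  then have "(\<lambda>k. (y k - coord (X N) k) + coord (X N) k) \<in> ell2"
    by (intro ell2_add) auto
  then have yl: "y \<in> ell2" by simp
  have eq: "Abs_l2 (\<lambda>k. y k - coord (X n) k) = Abs_l2 y - X n" if "(\<lambda>k. y k - coord (X n) k) \<in> ell2" for n
    using that by (intro l2_eqI) (simp add: Abs_l2_inverse yl)
  have "X \<longlonglongrightarrow> Abs_l2 y"
  proof (rule LIMSEQ_I)
    fix r :: real assume "r > 0"
    then obtain N where N: "\<forall>n\<ge>N. (\<lambda>k. y k - coord (X n) k) \<in> ell2 \<and>
        norm (Abs_l2 (\<lambda>k. y k - coord (X n) k)) \<le> r / 2"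
      using key[of "r / 2"] by auto
    have "norm (X n - Abs_l2 y) < r" if "n \<ge> N" for n
    proof -
      have "norm (Abs_l2 y - X n) \<le> r / 2"
        using N[rule_format, OF that] eq[of n] by simp
      then show ?thesis
        using \<open>r > 0\<close> by (simp add: norm_minus_commute)
    qed
    then show "\<exists>N. \<forall>n\<ge>N. norm (X n - Abs_l2 y) < r" by blast
  qed
  then show "convergent X" by (auto simp: convergent_def)
qed

section \<open>Coordinate basis vectors and the expansion in them\<close>

definition ket :: "'e \<Rightarrow> 'e l2" where
  "ket k = Abs_l2 (\<lambda>j. if j = k then 1 else 0)"

lemma coord_ket [simp]: "coord (ket k) j = (if j = k then 1 else 0)"
proof -
  have "(\<lambda>j. if j = k then 1 else 0 :: complex) \<in> ell2"
  proof (rule ell2_if_sums_bounded(1)[of _ 1])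
    fix F :: "'a set" assume "finite F"
    have "(\<Sum>j\<in>F. (cmod (if j = k then 1 else 0))\<^sup>2) = (\<Sum>j\<in>F. if j = k then 1 else 0)"
      by (intro sum.cong) auto
    then show "(\<Sum>j\<in>F. (cmod (if j = k then 1 else 0))\<^sup>2) \<le> 1\<^sup>2"
      using \<open>finite F\<close> by (simp add: sum.delta)
  qed simp
  then show ?thesis by (simp add: ket_def Abs_l2_inverse)
qed

text \<open>The squared distance from \<open>x\<close> to a finite partial sum is the tail of the
  series for its squared norm, hence tends to 0.\<close>

lemma has_sum_ket: "((\<lambda>k. scaleC (coord x k) (ket k)) has_sum x) UNIV"
proof -
  let ?f = "\<lambda>k. scaleC (coord x k) (ket k)"
  have sq: "(norm (sum ?f F - x))\<^sup>2 = (norm x)\<^sup>2 - (\<Sum>k\<in>F. (cmod (coord x k))\<^sup>2)" if F: "finite F" for F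
  proof -
    have c: "coord (sum ?f F - x) k = (if k \<in> F then 0 else - coord x k)" for k
    proof -
      have "(\<Sum>a\<in>F. coord x a * (if k = a then 1 else 0)) = (\<Sum>a\<in>F. if k = a then coord x a else 0)"
        by (intro sum.cong) auto
      then show ?thesis using F by (simp add: sum.delta)
    qed
    have "(norm (sum ?f F - x))\<^sup>2 = (\<Sum>\<^sub>\<infinity>k\<in>UNIV. (cmod (if k \<in> F then 0 else - coord x k))\<^sup>2)"
      unfolding norm_l2_square c ..
    also have "\<dots> = (\<Sum>\<^sub>\<infinity>k\<in>UNIV - F. (cmod (coord x k))\<^sup>2)"
      by (rule infsum_cong_neutral) auto
    also have "\<dots> = (\<Sum>\<^sub>\<infinity>k. (cmod (coord x k))\<^sup>2) - (\<Sum>\<^sub>\<infinity>k\<in>F. (cmod (coord x k))\<^sup>2)"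
      using F by (intro infsum_Diff coord_summable) auto
    finally show ?thesis using F by (simp add: norm_l2_square)
  qed
  have "((\<lambda>k. (cmod (coord x k))\<^sup>2) has_sum (norm x)\<^sup>2) UNIV"
    unfolding norm_l2_square by (rule has_sum_infsum[OF coord_summable])
  then have "((\<lambda>F. (norm x)\<^sup>2 - (\<Sum>k\<in>F. (cmod (coord x k))\<^sup>2)) \<longlongrightarrow> (norm x)\<^sup>2 - (norm x)\<^sup>2)
      (finite_subsets_at_top UNIV)"
    unfolding has_sum_def by (intro tendsto_diff tendsto_const)
  then have "((\<lambda>F. sqrt ((norm x)\<^sup>2 - (\<Sum>k\<in>F. (cmod (coord x k))\<^sup>2))) \<longlongrightarrow> sqrt 0)
      (finite_subsets_at_top UNIV)"
    by (intro tendsto_real_sqrt) simp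
  moreover have "\<forall>\<^sub>F F in finite_subsets_at_top UNIV.
      sqrt ((norm x)\<^sup>2 - (\<Sum>k\<in>F. (cmod (coord x k))\<^sup>2)) = norm (sum ?f F - x)"
    by (intro eventually_finite_subsets_at_top_weakI) (simp add: sq[symmetric])
  ultimately have "((\<lambda>F. norm (sum ?f F - x)) \<longlongrightarrow> 0) (finite_subsets_at_top UNIV)"
    by (simp add: filterlim_cong[OF refl refl])
  then show ?thesis
    unfolding has_sum_def by (simp add: tendsto_norm_zero_iff LIM_zero_iff)
qed

section \<open>Resolvents of bounded symmetric operators\<close>

lemma bounded_linear_cip_right: "bounded_linear (cip w)"
  by (rule bounded_linear_intro[of _ "norm w"])
     (auto simp: cip_add_right scaleR_scaleC cip_scaleC_right scaleR_conv_of_real mult.commute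
       intro: order_trans[OF norm_cip_le])

text \<open>An abstraction of the exterior block: bounded, complex linear, and symmetric for the
  complex inner product. It is interpreted below with \<open>op_l2 HEE\<close>.\<close>

locale bounded_symmetric =
  fixes M :: "'e l2 \<Rightarrow> 'e l2" and C :: real
  assumes M_add: "M (x + y) = M x + M y"
    and M_scaleC: "M (scaleC c x) = scaleC c (M x)"
    and C_nonneg: "C \<ge> 0"
    and M_bound: "norm (M x) \<le> C * norm x"
    and M_sym: "cip (M x) y = cip x (M y)"
begin

lemma M_diff: "M (x - y) = M x - M y"
  using M_add[of "x - y" y] by simp

lemma Im_cip_M: "Im (cip x (M x)) = 0"
  using cip_commute[of x "M x"] M_sym[of x x] by (metis cnj.simps(2) equal_neg_zero)

text \<open>By symmetry \<open>cip x (M x)\<close> is real, so the term with \<open>\<i>\<close>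
  adds nothing to the real part.\<close>

lemma coercive: "Re (cip x (scaleC s x + scaleC \<i> (M x))) = Re s * (norm x)\<^sup>2"
  by (simp add: cip_add_right cip_scaleC_right cip_self Im_cip_M)

text \<open>
  For \<open>Re s > 0\<close> the operator \<open>s + \<i>M = \<i>(M - \<i>s)\<close> is coercive, so that
  \<open>x \<mapsto> x - \<tau>((s + \<i>M) x - \<i>v)\<close> is a contraction for small \<open>\<tau> > 0\<close>.
\<close>
lemma resolvent_exists:
  assumes s: "Re s > 0"
  shows "\<exists>x. M x - scaleC (\<i> * s) x = v"
proof -
  define G where "G x = scaleC s x + scaleC \<i> (M x)" for x
  define K where "K = cmod s + C"
  have K: "Re s \<le> K" "K > 0"
    using s C_nonneg complex_Re_le_cmod[of s] by (auto simp: K_def)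
  \<comment> \<open>This value minimizes the contraction bound
    \<open>1 - 2 * \<tau> * Re s + \<tau>\<^sup>2 * K\<^sup>2\<close> over \<open>\<tau>\<close>;
    the minimum is \<open>q\<close>.\<close>
  define \<tau> where "\<tau> = Re s / K\<^sup>2"
  define q where "q = 1 - (Re s / K)\<^sup>2"
  have q: "0 \<le> q" "q < 1"
    using s K by (auto simp: q_def power_le_one_iff)
  have G_bound: "norm (G x) \<le> K * norm x" for x
  proof -
    have "norm (G x) \<le> norm (scaleC s x) + norm (scaleC \<i> (M x))"
      unfolding G_def by (rule norm_triangle_ineq)
    also have "\<dots> \<le> K * norm x"
      using M_bound[of x] by (simp add: K_def distrib_right)
    finally show ?thesis .
  qed
  have contr: "norm (d - \<tau> *\<^sub>R G d) \<le> sqrt q * norm d" for d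
  proof -
    have "(norm (d - \<tau> *\<^sub>R G d))\<^sup>2 = (norm d)\<^sup>2 - 2 * \<tau> * inner d (G d) + \<tau>\<^sup>2 * (norm (G d))\<^sup>2"
      unfolding power2_norm_eq_inner
      by (simp add: inner_diff_left inner_diff_right inner_commute power2_eq_square algebra_simps)
    also have "inner d (G d) = Re s * (norm d)\<^sup>2"
      by (simp add: inner_l2 G_def coercive)
    also have "(norm d)\<^sup>2 - 2 * \<tau> * (Re s * (norm d)\<^sup>2) + \<tau>\<^sup>2 * (norm (G d))\<^sup>2
        \<le> (norm d)\<^sup>2 - 2 * \<tau> * (Re s * (norm d)\<^sup>2) + \<tau>\<^sup>2 * (K * norm d)\<^sup>2"
      using G_bound[of d] by (intro add_left_mono mult_left_mono power_mono) auto
    also have "\<dots> = q * (norm d)\<^sup>2"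
      using K by (simp add: q_def \<tau>_def field_simps power2_eq_square)
    finally have "(norm (d - \<tau> *\<^sub>R G d))\<^sup>2 \<le> (sqrt q * norm d)\<^sup>2"
      using q by (simp add: power_mult_distrib)
    then show ?thesis by (rule power2_le_imp_le) (use q in auto)
  qed
  define T where "T x = x - \<tau> *\<^sub>R (G x - scaleC \<i> v)" for x
  have G_diff: "G (x - y) = G x - G y" for x y
    by (simp add: G_def M_diff scaleC_simps)
  have "dist (T x) (T y) \<le> sqrt q * dist x y" for x y
  proof -
    have "T x - T y = (x - y) - \<tau> *\<^sub>R G (x - y)"
      by (simp add: T_def G_diff algebra_simps)
    then show ?thesis using contr[of "x - y"] by (simp add: dist_norm)
  qed
  moreover have "0 \<le> sqrt q" "sqrt q < 1" using q by auto
  ultimately obtain x where "T x = x"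
    using banach_fix_type[of "sqrt q" T] by blast
  moreover have "\<tau> \<noteq> 0" using s K by (simp add: \<tau>_def)
  ultimately have "G x = scaleC \<i> v"
    by (simp add: T_def)
  then have "scaleC (-\<i>) (G x) = v"
    by (simp add: scaleC_simps)
  then show ?thesis
    by (intro exI[of _ x]) (simp add: G_def scaleC_simps)
qed

text \<open>Multiply the equation by \<open>\<i>\<close>, pair it with \<open>x\<close>, and compare
  coercivity with Cauchy-Schwarz. Uniqueness follows by taking \<open>v = 0\<close>.\<close>

lemma resolvent_bound:
  assumes s: "Re s > 0" and x: "M x - scaleC (\<i> * s) x = v"
  shows "norm x \<le> norm v / Re s"
proof (cases "x = 0")
  case False
  have "scaleC s x + scaleC \<i> (M x) = scaleC \<i> v"
    unfolding x[symmetric] by (simp add: scaleC_simps mult.assoc[symmetric])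
  then have "Re s * (norm x)\<^sup>2 = Re (cip x (scaleC \<i> v))"
    using coercive[of x s] by simp
  also have "\<dots> \<le> norm x * norm (scaleC \<i> v)"
    by (rule order_trans[OF complex_Re_le_cmod norm_cip_le])
  finally show ?thesis
    using s False by (simp add: field_simps power2_eq_square)
qed (use s in auto)

lemma resolvent_unique:
  assumes "Re s > 0" "M x - scaleC (\<i> * s) x = v" "M y - scaleC (\<i> * s) y = v"
  shows "x = y"
proof -
  have "M (x - y) - scaleC (\<i> * s) (x - y) = (M x - scaleC (\<i> * s) x) - (M y - scaleC (\<i> * s) y)"
    by (simp add: M_diff scaleC_simps)
  then have "M (x - y) - scaleC (\<i> * s) (x - y) = 0"
    by (simp add: assms)
  then have "norm (x - y) \<le> 0"
    using resolvent_bound[OF assms(1)] by fastforce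
  then show ?thesis by simp
qed

text \<open>The parameter is the Laplace variable \<open>s\<close>, the spectral parameter being
  \<open>\<i> * s\<close>. The value is meaningful for \<open>Re s > 0\<close>.\<close>

definition resolv :: "complex \<Rightarrow> 'e l2 \<Rightarrow> 'e l2" where
  "resolv s v = (THE x. M x - scaleC (\<i> * s) x = v)"

lemma resolv_eq:
  assumes "Re s > 0"
  shows "M (resolv s v) - scaleC (\<i> * s) (resolv s v) = v"
  unfolding resolv_def
  by (rule theI') (use resolvent_exists[OF assms] resolvent_unique[OF assms] in blast)

lemma resolv_eqI: "Re s > 0 \<Longrightarrow> M x - scaleC (\<i> * s) x = v \<Longrightarrow> resolv s v = x"
  using resolvent_unique resolv_eq by blast

lemma norm_resolv: "Re s > 0 \<Longrightarrow> norm (resolv s v) \<le> norm v / Re s"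
  using resolvent_bound resolv_eq by blast

text \<open>The first resolvent identity in the variable \<open>s\<close>: \<open>resolv t v\<close>
  plus the right-hand side solves the equation for \<open>s\<close>, and solutions are
  unique.\<close>

lemma resolv_identity:
  assumes "Re s > 0" "Re t > 0"
  shows "resolv s v - resolv t v = scaleC (\<i> * (s - t)) (resolv s (resolv t v))"
proof -
  let ?y = "resolv s (resolv t v)"
  have *: "M ?y = resolv t v + scaleC (\<i> * s) ?y" "M (resolv t v) = v + scaleC (\<i> * t) (resolv t v)"
    using resolv_eq[OF assms(1), of "resolv t v"] resolv_eq[OF assms(2), of v]
    by (simp_all add: algebra_simps)
  have "resolv s v = resolv t v + scaleC (\<i> * (s - t)) ?y"
    by (rule resolv_eqI[OF assms(1)], rule l2_eqI)
       (simp add: M_add M_scaleC * algebra_simps)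
  then show ?thesis by simp
qed

lemma tendsto_resolv:
  assumes t: "Re t > 0"
  shows "((\<lambda>s. resolv s v) \<longlongrightarrow> resolv t v) (at t)"
proof -
  have ev: "\<forall>\<^sub>F s in at t. Re s > 0"
    using eventually_at_in_open'[OF open_halfspace_Re_gt[of 0]] t by auto
  have "\<forall>\<^sub>F s in at t. norm (resolv s v - resolv t v) \<le> cmod (s - t) * (norm v / Re t / Re s)"
    using ev
  proof eventually_elim
    case (elim s)
    have "norm (resolv s (resolv t v)) \<le> norm (resolv t v) / Re s"
      by (rule norm_resolv[OF elim])
    also have "\<dots> \<le> norm v / Re t / Re s"
      using norm_resolv[OF t] elim by (intro divide_right_mono) auto
    finally show ?case
      unfolding resolv_identity[OF elim t] norm_scaleC by (simp only: norm_mult norm_ii mult_1 mult_left_mono norm_ge_zero)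
  qed
  moreover have "((\<lambda>s. cmod (s - t) * (norm v / Re t / Re s)) \<longlongrightarrow> 0) (at t)"
    by (rule tendsto_eq_intros refl | use t in simp)+
  ultimately have "((\<lambda>s. resolv s v - resolv t v) \<longlongrightarrow> 0) (at t)"
    by (rule Lim_null_comparison)
  then show ?thesis by (rule LIM_zero_cancel)
qed

text \<open>By the resolvent identity the difference quotient is exactly
  \<open>\<i> * cip w (resolv s (resolv t v))\<close>, so continuity of the resolvent gives the
  limit.\<close>

lemma resolv_has_field_derivative:
  assumes t: "Re t > 0"
  shows "((\<lambda>s. cip w (resolv s v)) has_field_derivative \<i> * cip w (resolv t (resolv t v))) (at t)"
proof -
  have ev: "\<forall>\<^sub>F s in at t. Re s > 0 \<and> s \<noteq> t"
    using eventually_at_in_open'[OF open_halfspace_Re_gt[of 0], of t] t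
    by (auto simp: eventually_conj_iff eventually_neq_at_within)
  have lim: "((\<lambda>s. \<i> * cip w (resolv s (resolv t v))) \<longlongrightarrow> \<i> * cip w (resolv t (resolv t v))) (at t)"
    by (intro tendsto_intros bounded_linear.tendsto[OF bounded_linear_cip_right] tendsto_resolv t)
  show ?thesis
    unfolding has_field_derivative_iff
  proof (rule Lim_transform_eventually[OF lim])
    show "\<forall>\<^sub>F s in at t. \<i> * cip w (resolv s (resolv t v)) = (cip w (resolv s v) - cip w (resolv t v)) / (s - t)"
      using ev
    proof eventually_elim
      case (elim s)
      then show ?case
        by (simp add: cip_diff_right[symmetric] resolv_identity[OF _ t] cip_scaleC_right)
    qed
  qed
qed

text \<open>With \<open>x = resolv s v\<close> and \<open>y = resolv s x\<close>, the two equations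
  combine to \<open>- s\<^sup>2 y - v = \<i> s M y - M x\<close>. Since \<open>x\<close> is of order
  \<open>1/s\<close> and \<open>y\<close> of order \<open>1/s\<^sup>2\<close>, the error is of order
  \<open>1/s\<close>.\<close>

lemma resolv_square_asymptotic:
  "((\<lambda>s. of_real (s\<^sup>2) * cip w (resolv (of_real s) (resolv (of_real s) v))) \<longlongrightarrow> - cip w v) at_top"
proof -
  have "\<forall>\<^sub>F s in at_top. norm (scaleC (- of_real (s\<^sup>2)) (resolv (of_real s) (resolv (of_real s) v)) - v)
      \<le> 2 * C * norm v / s"
    using eventually_gt_at_top[of 0]
  proof eventually_elim
    case (elim s)
    then have s: "Re (of_real s) > 0" by simp
    define x where "x = resolv (of_real s) v"
    define y where "y = resolv (of_real s) x"
    have nx: "norm x \<le> norm v / s" and ny: "norm y \<le> norm x / s"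
      using norm_resolv[OF s] by (auto simp: x_def y_def)
    have "scaleC (\<i> * of_real s) x = M x - v" "scaleC (\<i> * of_real s) y = M y - x"
      using resolv_eq[OF s, of v] resolv_eq[OF s, of x] by (auto simp: x_def y_def algebra_simps)
    then have "scaleC (\<i> * of_real s) (scaleC (\<i> * of_real s) y) = scaleC (\<i> * of_real s) (M y) - (M x - v)"
      by (simp add: scaleC_simps)
    then have "scaleC (- of_real (s\<^sup>2)) y - v = scaleC (\<i> * of_real s) (M y) - M x"
      by (simp add: scaleC_simps(7) power2_eq_square algebra_simps)
    then have "norm (scaleC (- of_real (s\<^sup>2)) y - v) \<le> norm (scaleC (\<i> * of_real s) (M y)) + norm (M x)"
      using norm_triangle_ineq4 by metis
    also have "\<dots> \<le> s * (C * norm y) + C * norm x"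
      using elim M_bound by (intro add_mono) (auto simp: norm_mult)
    also have "\<dots> \<le> s * (C * (norm x / s)) + C * norm x"
      using elim ny C_nonneg by (intro add_mono mult_left_mono) auto
    also have "\<dots> = 2 * (C * norm x)"
      using elim by simp
    also have "\<dots> \<le> 2 * (C * (norm v / s))"
      using nx C_nonneg by (intro mult_left_mono) auto
    finally show ?case by (simp add: x_def y_def)
  qed
  moreover have "((\<lambda>s::real. 2 * C * norm v / s) \<longlongrightarrow> 0) at_top"
    by (rule tendsto_divide_0[OF tendsto_const filterlim_at_top_imp_at_infinity[OF filterlim_ident]])
  ultimately have "((\<lambda>s. scaleC (- of_real (s\<^sup>2)) (resolv (of_real s) (resolv (of_real s) v)) - v) \<longlongrightarrow> 0) at_top"
    by (rule Lim_null_comparison)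
  then have "((\<lambda>s. scaleC (- of_real (s\<^sup>2)) (resolv (of_real s) (resolv (of_real s) v))) \<longlongrightarrow> v) at_top"
    by (rule LIM_zero_cancel)
  then have "((\<lambda>s. cip w (scaleC (- of_real (s\<^sup>2)) (resolv (of_real s) (resolv (of_real s) v)))) \<longlongrightarrow> cip w v) at_top"
    by (rule bounded_linear.tendsto[OF bounded_linear_cip_right])
  then have "((\<lambda>s. - cip w (scaleC (- of_real (s\<^sup>2)) (resolv (of_real s) (resolv (of_real s) v)))) \<longlongrightarrow> - cip w v) at_top"
    by (rule tendsto_minus)
  then show ?thesis by (simp add: cip_scaleC_right)
qed

end

section \<open>Operators on \<open>\<ell>\<^sup>2\<close> given by matrices\<close>

definition op_l2 :: "('e \<Rightarrow> 'e \<Rightarrow> complex) \<Rightarrow> 'e l2 \<Rightarrow> 'e l2" where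
  "op_l2 M x = Abs_l2 (op_apply M (coord x))"

lemma coord_op_l2: "bounded_on_ell2 M \<Longrightarrow> coord (op_l2 M x) = op_apply M (coord x)"
  unfolding op_l2_def by (rule Abs_l2_inverse) (auto simp: bounded_on_ell2_def)

text \<open>Symmetry is the substantial part. On basis vectors it is the Hermitian condition on the
  entries; boundedness lets it pass through the expansion of \<open>y\<close>, in place of an
  exchange of infinite sums.\<close>

lemma bounded_symmetric_op_l2:
  assumes M: "bounded_on_ell2 M" and herm: "\<And>j k. M j k = cnj (M k j)"
  shows "\<exists>C. bounded_symmetric (op_l2 M) C"
proof -
  note c = coord_op_l2[OF M]
  have sm: "(\<lambda>k. M j k * coord x k) summable_on UNIV" for j x
    using M unfolding bounded_on_ell2_def by auto
  obtain C where C: "\<And>x. x \<in> ell2 \<Longrightarrow> ell2_norm (op_apply M x) \<le> C * ell2_norm x"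
    using M unfolding bounded_on_ell2_def by blast
  have bound: "norm (op_l2 M x) \<le> \<bar>C\<bar> * norm x" for x
  proof -
    have "norm (op_l2 M x) \<le> C * norm x"
      using C[of "coord x"] by (simp add: norm_l2_eq c)
    also have "\<dots> \<le> \<bar>C\<bar> * norm x"
      by (rule mult_right_mono) auto
    finally show ?thesis .
  qed
  have add: "op_l2 M (x + y) = op_l2 M x + op_l2 M y" for x y
    by (rule l2_eqI) (simp add: c op_apply_def distrib_left infsum_add sm)
  have scale: "op_l2 M (scaleC a x) = scaleC a (op_l2 M x)" for a x
    by (rule l2_eqI) (simp add: c op_apply_def mult.left_commute[of _ a] infsum_cmult_right')
  have "bounded_linear (op_l2 M)"
    by (rule bounded_linear_intro[of _ "\<bar>C\<bar>"])
       (use bound in \<open>auto simp: add scale scaleR_scaleC mult.commute\<close>)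
  then have bl: "bounded_linear (\<lambda>y. cip x (op_l2 M y))" for x
    by (rule bounded_linear_compose[OF bounded_linear_cip_right])
  have ket: "cip x (op_l2 M (ket k)) = cnj (coord (op_l2 M x) k)" for x k
  proof -
    have "coord (op_l2 M (ket k)) j = M j k" for j
    proof -
      have "coord (op_l2 M (ket k)) j = (\<Sum>\<^sub>\<infinity>l\<in>{k}. M j k)"
        unfolding c op_apply_def by (rule infsum_cong_neutral) auto
      then show ?thesis by simp
    qed
    then show ?thesis
      unfolding c cip_def op_apply_def infsum_cnj[symmetric]
      by (intro infsum_cong) (metis herm complex_cnj_mult mult.commute)
  qed
  have sym: "cip (op_l2 M x) y = cip x (op_l2 M y)" for x y
  proof -
    have "((\<lambda>k. cip x (op_l2 M (scaleC (coord y k) (ket k)))) has_sum cip x (op_l2 M y)) UNIV"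
      by (rule has_sum_bounded_linear[OF bl has_sum_ket])
    then have "((\<lambda>k. cnj (coord (op_l2 M x) k) * coord y k) has_sum cip x (op_l2 M y)) UNIV"
      by (simp add: scale cip_scaleC_right ket mult.commute)
    then show ?thesis
      unfolding cip_def[of "op_l2 M x" y] by (rule infsumI)
  qed
  show ?thesis
    by (rule exI[of _ "\<bar>C\<bar>"], unfold_locales) (auto simp: add scale bound sym)
qed

text \<open>This links the resolvent in the definition of \<open>DtN\<close> to
  \<open>resolv\<close>; existence and uniqueness carry over through \<open>coord\<close> and
  \<open>Abs_l2\<close>.\<close>

lemma (in bounded_symmetric) resolvent_apply_eq:
  assumes "M = op_l2 m" "bounded_on_ell2 m" "Re s > 0"
  shows "resolvent_apply m (\<i> * s) (coord v) = coord (resolv s v)"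
  unfolding resolvent_apply_def
proof (rule the_equality)
  have "op_apply m (coord (resolv s v)) j - \<i> * s * coord (resolv s v) j = coord v j" for j
    using resolv_eq[OF assms(3), of v] coord_op_l2[OF assms(2)] coord_diff coord_scaleC
    unfolding assms(1) by metis
  then show "coord (resolv s v) \<in> ell2 \<and>
      (\<forall>j. op_apply m (coord (resolv s v)) j - \<i> * s * coord (resolv s v) j = coord v j)" by simp
next
  fix x assume x: "x \<in> ell2 \<and> (\<forall>j. op_apply m x j - \<i> * s * x j = coord v j)"
  then have cx: "coord (Abs_l2 x) = x" by (simp add: Abs_l2_inverse)
  have "resolv s v = Abs_l2 x"
    by (rule resolv_eqI[OF assms(3)], rule l2_eqI)
       (use x in \<open>simp add: assms(1) coord_op_l2[OF assms(2)] cx\<close>)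
  then show "x = coord (resolv s v)" by (simp add: cx)
qed

section \<open>The interpolation conditions\<close>

lemma
  fixes A :: "'a::semiring_1^'n^'m"
  assumes "invertible A"
  shows matrix_inv_right: "A ** matrix_inv A = mat 1"
    and matrix_inv_left: "matrix_inv A ** A = mat 1"
  using someI_ex[OF assms[unfolded invertible_def]] unfolding matrix_inv_def by blast+

lemma holomorphic_on_det:
  fixes F :: "complex \<Rightarrow> complex^'n^'n"
  assumes "\<And>i j. (\<lambda>z. F z $ i $ j) holomorphic_on S"
  shows "(\<lambda>z. det (F z)) holomorphic_on S"
  unfolding det_def by (intro holomorphic_intros assms)

text \<open>
  Cramer's rule writes the entries of \<open>R\<^sub>1\<^sub>,\<^sub>1(1/\<lambda>) = \<lambda>(1 - \<lambda>B)\<^sup>-\<^sup>1A\<close> as \<open>\<lambda>\<close> times a rational function that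
  is regular at \<open>\<lambda> = 0\<close>.
\<close>
lemma R11_deriv_tendsto:
  fixes A B :: "complex^'g^'g"
  shows "(matrix_deriv (\<lambda>z. R11 A B (inverse z)) \<longlongrightarrow> A) (at 0)"
proof (intro vec_tendstoI)
  fix i j :: 'g
  \<comment> \<open>\<open>D z\<close> is \<open>1 - z B\<close>, regular at 0 unlike
    \<open>mat (inverse z) - B\<close>. \<open>N z\<close> is the Cramer numerator for component
    \<open>i\<close> of the solution with right-hand side column \<open>j\<close> of
    \<open>A\<close>.\<close>
  define D :: "complex \<Rightarrow> complex^'g^'g" where "D z = (\<chi> r c. (if r = c then 1 else 0) - z * B $ r $ c)" for z
  define N :: "complex \<Rightarrow> complex^'g^'g" where "N z = (\<chi> r c. if c = i then column j A $ r else D z $ r $ c)" for z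
  define h where "h z = det (N z) / det (D z)" for z
  define S where "S = {z. det (D z) \<noteq> 0}"
  have D_entry: "(\<lambda>z. D z $ r $ c) holomorphic_on T" for r c T
    unfolding D_def by (auto intro!: holomorphic_intros)
  have N_entry: "(\<lambda>z. N z $ r $ c) holomorphic_on T" for r c T
    using D_entry by (cases "c = i") (auto simp: N_def)
  have holD: "(\<lambda>z. det (D z)) holomorphic_on T" for T
    by (intro holomorphic_on_det D_entry)
  have holN: "(\<lambda>z. det (N z)) holomorphic_on T" for T
    by (intro holomorphic_on_det N_entry)
  have "open ((\<lambda>z. det (D z)) -` (- {0}))"
    using holomorphic_on_imp_continuous_on[OF holD[of UNIV]] by (intro open_vimage) auto
  then have S: "open S"
    by (simp add: S_def vimage_def)
  have D0: "D 0 = mat 1"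
    by (simp add: D_def mat_def vec_eq_iff)
  have "0 \<in> S" by (simp add: S_def D0)
  have hol: "(\<lambda>z. z * h z) holomorphic_on S" "h holomorphic_on S"
    unfolding h_def by (auto intro!: holomorphic_intros holD holN simp: S_def)
  have h0: "h 0 = A $ i $ j"
  proof -
    have "mat 1 *v column j A = column j A" by simp
    then have "column j A = (\<chi> k. det (\<chi> r c. if c = k then column j A $ r else (mat 1 :: complex^'g^'g) $ r $ c)
        / det (mat 1 :: complex^'g^'g))"
      by (subst (asm) cramer) auto
    then have "column j A $ i = det (\<chi> r c. if c = i then column j A $ r else (mat 1 :: complex^'g^'g) $ r $ c)
        / det (mat 1 :: complex^'g^'g)"
      by (metis (no_types, lifting) vec_lambda_beta)
    moreover have "column j A $ i = A $ i $ j" by (simp add: column_def)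
    ultimately show ?thesis by (simp add: h_def N_def D0 cong: if_cong)
  qed
  have R_eq: "R11 A B (inverse z) $ i $ j = z * h z" if z: "z \<in> S" "z \<noteq> 0" for z
  proof -
    let ?W = "mat (inverse z) - B"
    have DW: "D z $ r $ c = z * ?W $ r $ c" for r c
      using z by (simp add: D_def mat_def right_diff_distrib)
    define Y where "Y = (\<chi> r c. z * matrix_inv (D z) $ r $ c)"
    have inv: "invertible (D z)" using z by (simp add: S_def invertible_det_nz)
    have "(?W ** Y) $ r $ c = (D z ** matrix_inv (D z)) $ r $ c" for r c
      by (simp add: matrix_matrix_mult_def Y_def DW mult_ac)
    then have "?W ** Y = mat 1"
      using matrix_inv_right[OF inv] by (simp add: vec_eq_iff)
    then have invW: "invertible ?W"
      using invertible_right_inverse by blast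
    define X where "X = R11 A B (inverse z)"
    have WX: "?W ** X = A"
      by (simp add: X_def R11_def matrix_mul_assoc matrix_inv_right[OF invW])
    have "D z *v (inverse z *s column j X) = column j A"
    proof (intro vec_eq_iff[THEN iffD2] allI)
      fix r
      have "(D z *v (inverse z *s column j X)) $ r = (\<Sum>c\<in>UNIV. ?W $ r $ c * X $ c $ j)"
        unfolding matrix_vector_mult_def vec_lambda_beta
        using z by (intro sum.cong) (auto simp: DW column_def)
      also have "\<dots> = (?W ** X) $ r $ j" by (simp add: matrix_matrix_mult_def)
      finally show "(D z *v (inverse z *s column j X)) $ r = column j A $ r"
        by (simp add: WX column_def)
    qed
    then have "inverse z *s column j X =
        (\<chi> k. det (\<chi> r c. if c = k then column j A $ r else D z $ r $ c) / det (D z))"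
      using z by (subst (asm) cramer) (auto simp: S_def)
    then have "(inverse z *s column j X) $ i = det (\<chi> r c. if c = i then column j A $ r else D z $ r $ c) / det (D z)"
      by (metis (no_types, lifting) vec_lambda_beta)
    moreover have "column j X $ i = X $ i $ j" by (simp add: column_def)
    ultimately show ?thesis
      using z by (simp add: X_def h_def N_def field_simps)
  qed
  have dh: "deriv (\<lambda>z. z * h z) 0 = A $ i $ j"
  proof (rule DERIV_imp_deriv)
    have "(h has_field_derivative deriv h 0) (at 0)"
      using holomorphic_derivI[OF hol(2) S \<open>0 \<in> S\<close>] .
    then show "((\<lambda>z. z * h z) has_field_derivative A $ i $ j) (at 0)"
      by (auto intro!: derivative_eq_intros simp: h0)
  qed
  have "continuous_on S (deriv (\<lambda>z. z * h z))"
    by (intro holomorphic_on_imp_continuous_on holomorphic_deriv hol S)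
  then have "(deriv (\<lambda>z. z * h z) \<longlongrightarrow> A $ i $ j) (at 0)"
    using S \<open>0 \<in> S\<close> unfolding dh[symmetric] continuous_on_eq_continuous_at[OF S] isCont_def by blast
  moreover have "\<forall>\<^sub>F z in at 0. deriv (\<lambda>z. z * h z) z = matrix_deriv (\<lambda>z. R11 A B (inverse z)) z $ i $ j"
    using eventually_at_in_open[OF S \<open>0 \<in> S\<close>]
  proof eventually_elim
    case (elim z)
    \<comment> \<open>The convention \<open>inverse 0 = 0\<close> leaves agreement at 0 open;
      equality of derivatives at \<open>z\<close> only takes a neighbourhood of \<open>z\<close>
      avoiding 0.\<close>
    have "\<forall>\<^sub>F w in nhds z. w \<in> S - {0}"
      using elim S by (intro eventually_nhds_in_open) auto
    then have "\<forall>\<^sub>F w in nhds z. w * h w = R11 A B (inverse w) $ i $ j"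
      by eventually_elim (simp add: R_eq)
    then show ?case
      unfolding matrix_deriv_def vec_lambda_beta by (intro deriv_cong_ev refl)
  qed
  ultimately show "((\<lambda>z. matrix_deriv (\<lambda>z. R11 A B (inverse z)) z $ i $ j) \<longlongrightarrow> A $ i $ j) (at 0)"
    by (rule Lim_transform_eventually)
qed

text \<open>\<open>F\<close> is known only on the right half-plane. As the limit at 0 is assumed to
  exist, it can be evaluated along \<open>1/s\<close> with real \<open>s\<close> tending to
  infinity. There the chain rule gives the factor \<open>- s\<^sup>2\<close>, and
  \<open>resolv_square_asymptotic\<close> applies.\<close>

lemma (in bounded_symmetric) deriv_resolv_tendsto_unique:
  assumes F: "\<And>s. Re s > 0 \<Longrightarrow> F s = - cip w (resolv s v)"
    and l: "(deriv (\<lambda>z. F (inverse z)) \<longlongrightarrow> l) (at 0)"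
  shows "l = - \<i> * cip w v"
proof -
  have d: "deriv (\<lambda>z. F (inverse z)) (of_real (inverse s)) =
      \<i> * (of_real (s\<^sup>2) * cip w (resolv (of_real s) (resolv (of_real s) v)))" if s: "s > 0" for s
  proof (rule DERIV_imp_deriv)
    have "(F has_field_derivative - (\<i> * cip w (resolv (of_real s) (resolv (of_real s) v)))) (at (of_real s))"
    proof (rule has_field_derivative_transform_within_open)
      show "((\<lambda>s. - cip w (resolv s v)) has_field_derivative
          - (\<i> * cip w (resolv (of_real s) (resolv (of_real s) v)))) (at (of_real s))"
        using s by (intro DERIV_minus resolv_has_field_derivative) simp
    qed (use s in \<open>auto simp: F intro: open_halfspace_Re_gt\<close>)
    then have "(F has_field_derivative - (\<i> * cip w (resolv (of_real s) (resolv (of_real s) v))))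
        (at (inverse (of_real (inverse s))))"
      by simp
    moreover have "(inverse has_field_derivative - (of_real (s\<^sup>2))) (at (complex_of_real (inverse s)))"
      using s DERIV_inverse[of "complex_of_real (inverse s)"] by (simp add: power2_eq_square)
    ultimately have "((\<lambda>z. F (inverse z)) has_field_derivative
        - (\<i> * cip w (resolv (of_real s) (resolv (of_real s) v))) * - (of_real (s\<^sup>2))) (at (of_real (inverse s)))"
      by (rule DERIV_chain2)
    then show "((\<lambda>z. F (inverse z)) has_field_derivative
        \<i> * (of_real (s\<^sup>2) * cip w (resolv (of_real s) (resolv (of_real s) v)))) (at (of_real (inverse s)))"
      by (simp add: mult_ac)
  qed
  have "filterlim (\<lambda>s. complex_of_real (inverse s)) (at 0) at_top"
    unfolding filterlim_at
  proof
    have "((\<lambda>s. complex_of_real (inverse s)) \<longlongrightarrow> of_real 0) at_top"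
      by (intro tendsto_of_real tendsto_inverse_0_at_top filterlim_ident)
    then show "((\<lambda>s. complex_of_real (inverse s)) \<longlongrightarrow> 0) at_top" by simp
    show "\<forall>\<^sub>F s in at_top. complex_of_real (inverse s) \<in> UNIV \<and> complex_of_real (inverse s) \<noteq> 0"
      using eventually_gt_at_top[of 0] by eventually_elim simp
  qed
  then have "((\<lambda>s. deriv (\<lambda>z. F (inverse z)) (of_real (inverse s))) \<longlongrightarrow> l) at_top"
    by (rule filterlim_compose[OF l])
  moreover have "\<forall>\<^sub>F s in at_top. deriv (\<lambda>z. F (inverse z)) (of_real (inverse s)) =
      \<i> * (of_real (s\<^sup>2) * cip w (resolv (of_real s) (resolv (of_real s) v)))"
    using eventually_gt_at_top[of 0] by eventually_elim (rule d)
  ultimately have "((\<lambda>s. \<i> * (of_real (s\<^sup>2) * cip w (resolv (of_real s) (resolv (of_real s) v)))) \<longlongrightarrow> l) at_top"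
    by (rule Lim_transform_eventually)
  moreover have "((\<lambda>s. \<i> * (of_real (s\<^sup>2) * cip w (resolv (of_real s) (resolv (of_real s) v))))
      \<longlongrightarrow> \<i> * - cip w v) at_top"
    by (intro tendsto_mult tendsto_const resolv_square_asymptotic)
  ultimately show ?thesis
    using tendsto_unique[OF trivial_limit_at_top_linorder] by fastforce
qed

text \<open>
  If \<open>u\<close> is a left null vector of \<open>K\<close>, then \<open>D(1 + \<^term>\<open>cnj u\<close> u\<^sup>T)\<close> acts on \<open>K\<close> in the same way as \<open>D\<close>.
\<close>
lemma invertible_factor_not_unique:
  fixes D K :: "complex^'n^'n"
  assumes D: "invertible D" and K: "\<not> invertible K"
  obtains D' where "invertible D'" "D' ** K = D ** K" "D' \<noteq> D"
proof -
  have "\<not> invertible (transpose K)"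
    using K by (simp add: invertible_det_nz)
  then obtain u where u: "transpose K *v u = 0" "u \<noteq> 0"
    unfolding invertible_left_inverse matrix_left_invertible_ker by blast
  define E :: "complex^'n^'n" where "E = (\<chi> i j. cnj (u $ i) * u $ j)"
  have "(E ** K) $ i $ j = 0" for i j
  proof -
    have "(E ** K) $ i $ j = cnj (u $ i) * (transpose K *v u) $ j"
      by (simp add: E_def matrix_matrix_mult_def matrix_vector_mult_def transpose_def sum_distrib_left mult_ac)
    then show ?thesis unfolding u(1) by simp
  qed
  then have EK: "E ** K = 0" by (simp add: vec_eq_iff)
  have "(mat 1 + E) ** K = mat 1 ** K + E ** K"
    by (simp only: matrix_matrix_mult_def vec_eq_iff vec_lambda_beta vector_add_component
        distrib_right sum.distrib simp_thms)
  then have add_EK: "(mat 1 + E) ** K = K"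
    by (simp add: EK)
  \<comment> \<open>A kernel vector is \<open>- c\<close> times the conjugate of \<open>u\<close>,
    where \<open>c\<close> is the bilinear product of \<open>u\<close> and \<open>y\<close>.
    Inserting this into \<open>c\<close> gives
    \<open>(1 + \<parallel>u\<parallel>\<^sup>2) c = 0\<close>.\<close>
  have "y = 0" if y: "(mat 1 + E) *v y = 0" for y
  proof -
    define c where "c = (\<Sum>j\<in>UNIV. u $ j * y $ j)"
    have y_eq: "y $ i = - (cnj (u $ i) * c)" for i
    proof -
      have "(E *v y) $ i = cnj (u $ i) * c"
        by (simp add: E_def c_def matrix_vector_mult_def sum_distrib_left mult_ac)
      moreover have "y + E *v y = 0"
        using y by (simp add: matrix_vector_mult_add_rdistrib)
      ultimately show ?thesis
        by (metis add_eq_0_iff2 vector_uminus_component)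
    qed
    have "c = (\<Sum>j\<in>UNIV. - (of_real ((cmod (u $ j))\<^sup>2) * c))"
      by (subst (1) c_def, rule sum.cong[OF refl], subst y_eq)
        (simp only: complex_norm_square mult_ac mult_minus_right mult_minus_left)
    also have "\<dots> = - (of_real (\<Sum>j\<in>UNIV. (cmod (u $ j))\<^sup>2) * c)"
      by (simp add: sum_negf sum_distrib_right)
    finally have "of_real (1 + (\<Sum>j\<in>UNIV. (cmod (u $ j))\<^sup>2)) * c = 0"
      by (simp add: distrib_right eq_neg_iff_add_eq_0)
    moreover have "1 + (\<Sum>j\<in>UNIV. (cmod (u $ j))\<^sup>2) > 0"
      by (intro add_pos_nonneg sum_nonneg) auto
    ultimately have "c = 0"
      by (metis less_irrefl mult_eq_0_iff of_real_eq_0_iff)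
    then show ?thesis using y_eq by (simp add: vec_eq_iff)
  qed
  then have "invertible (mat 1 + E)"
    unfolding invertible_left_inverse matrix_left_invertible_ker by blast
  then have "invertible (D ** (mat 1 + E))"
    using D by (simp add: invertible_mult)
  moreover have "(D ** (mat 1 + E)) ** K = D ** K"
    by (simp only: matrix_mul_assoc[symmetric] add_EK)
  moreover have "D ** (mat 1 + E) \<noteq> D"
  proof
    assume "D ** (mat 1 + E) = D"
    then have "D ** E = 0" by (simp add: matrix_add_ldistrib)
    then have "matrix_inv D ** (D ** E) = 0" by simp
    then have "E = 0" by (simp add: matrix_mul_assoc matrix_inv_left[OF D])
    then have "cnj (u $ i) * u $ i = 0" for i
      by (simp add: E_def vec_eq_iff)
    then show False using u(2) by (simp add: vec_eq_iff)
  qed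
  ultimately show ?thesis by (rule that)
qed

section \<open>Stability\<close>

text \<open>The Lyapunov function is the squared norm of \<open>L x\<close>: it does not increase
  along solutions, and it controls the norm of \<open>x\<close> from both sides.\<close>

lemma lyapunov_stable_zero_if_dissipative:
  fixes F :: "'a::real_normed_vector \<Rightarrow> 'a" and L :: "'a \<Rightarrow> 'b::real_inner"
  assumes L: "bounded_linear L" and F0: "F 0 = 0"
    and below: "\<And>x. norm x \<le> c * norm (L x)"
    and diss: "\<And>x. inner (L x) (L (F x)) \<le> 0"
  shows "lyapunov_stable_zero F"
proof -
  obtain K where K: "K > 0" "\<And>x. norm (L x) \<le> norm x * K"
    using bounded_linear.pos_bounded[OF L] by blast
  define d where "d = max c 1"
  have d: "d > 0" by (simp add: d_def)
  have below': "norm x \<le> d * norm (L x)" for x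
  proof -
    have "c * norm (L x) \<le> d * norm (L x)"
      by (rule mult_right_mono) (auto simp: d_def)
    then show ?thesis using below[of x] by linarith
  qed
  have decr: "norm (L (x t)) \<le> norm (L (x 0))" if x: "solves_ode F T x" and t: "0 \<le> t" "t < T" for T x t
  proof -
    define g where "g s = inner (L (x s)) (L (x s))" for s
    have D: "(x has_vector_derivative F (x s)) (at s within {0..<T})" if "s \<in> {0..<T}" for s
      using x that by (auto simp: solves_ode_def)
    have "g t \<le> g 0"
    \<comment> \<open>At time 0 only a one-sided derivative is given, so derivatives in the open
      interval are combined with continuity on the closed one.\<close>
    proof (rule DERIV_nonpos_imp_decreasing_open[OF t(1)])
      fix s assume s: "0 < s" "s < t"
      have "(x has_vector_derivative F (x s)) (at s within {0<..<T})"
        by (rule has_vector_derivative_within_subset[OF D]) (use s t in auto)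
      then have "(x has_vector_derivative F (x s)) (at s)"
        using s t by (simp add: at_within_open[of s "{0<..<T}"])
      then have "((\<lambda>s. L (x s)) has_derivative (\<lambda>h. h *\<^sub>R L (F (x s)))) (at s)"
        using bounded_linear.has_vector_derivative[OF L] has_vector_derivative_def by blast
      then have "(g has_derivative (\<lambda>h. inner (L (x s)) (h *\<^sub>R L (F (x s))) + inner (h *\<^sub>R L (F (x s))) (L (x s)))) (at s)"
        unfolding g_def by (intro has_derivative_inner)
      then have "(g has_real_derivative 2 * inner (L (x s)) (L (F (x s)))) (at s)"
        by (rule has_derivative_imp_has_field_derivative) (simp add: inner_commute)
      then show "\<exists>y. (g has_real_derivative y) (at s) \<and> y \<le> 0"
        using diss[of "x s"] by (intro exI[of _ "2 * inner (L (x s)) (L (F (x s)))"]) simp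
    next
      have "continuous_on {0..<T} x"
        unfolding continuous_on_eq_continuous_within using D has_vector_derivative_continuous by blast
      then have "continuous_on {0..t} x"
        by (rule continuous_on_subset) (use t in auto)
      then show "continuous_on {0..t} g"
        unfolding g_def by (intro continuous_intros bounded_linear.continuous_on[OF L])
    qed
    then show ?thesis by (simp add: g_def norm_le)
  qed
  have "norm (x t) < \<epsilon>"
    if "\<epsilon> > 0" "solves_ode F T x" "norm (x 0) < \<epsilon> / (d * K)" "t \<in> {0..<T}" for \<epsilon> T x t
  proof -
    have "norm (x t) \<le> d * norm (L (x t))" by (rule below')
    also have "\<dots> \<le> d * (norm (x 0) * K)"
      using decr[OF that(2), of t] K(2)[of "x 0"] that(4) d by (intro mult_left_mono) auto
    also have "\<dots> < \<epsilon>"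
      using that(3) d K(1) by (simp add: field_simps)
    finally show ?thesis .
  qed
  moreover have "\<epsilon> / (d * K) > 0" if "\<epsilon> > 0" for \<epsilon>
    using that d K(1) by simp
  ultimately show ?thesis
    unfolding lyapunov_stable_zero_def using F0 by blast
qed

lemma invertible_scaled:
  fixes A A' :: "'a::field^'n^'n"
  assumes A: "invertible A" and A': "\<And>x. A' *v x = c *s (A *v x)" and c: "c \<noteq> 0"
  shows "invertible A'"
proof -
  have "x = 0" if "A' *v x = 0" for x
  proof -
    have "A *v x = A *v 0" using that c by (simp add: A')
    then show ?thesis using inj_matrix_vector_mult[OF A] by (rule injD[rotated])
  qed
  then show ?thesis
    unfolding invertible_left_inverse matrix_left_invertible_ker by blast
qed

section \<open>Linear combinations, Gram matrices and Hermitian forms\<close>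

definition comb :: "('g::finite \<Rightarrow> 'e l2) \<Rightarrow> complex^'g \<Rightarrow> 'e l2" where
  "comb v h = (\<Sum>a\<in>UNIV. scaleC (h $ a) (v a))"

definition gram :: "('g \<Rightarrow> 'e l2) \<Rightarrow> ('h \<Rightarrow> 'e l2) \<Rightarrow> complex^'h^'g" where
  "gram v w = (\<chi> a b. cip (v a) (w b))"

definition hdot :: "complex^'n \<Rightarrow> complex^'n \<Rightarrow> complex" where
  "hdot x y = (\<Sum>a\<in>UNIV. cnj (x $ a) * y $ a)"

lemma inner_eq_Re_hdot: "inner x y = Re (hdot x y)" for x y :: "complex^'n"
  by (simp add: inner_vec_def hdot_def inner_complex_def)

lemma hdot_simps:
  "hdot x (y + z) = hdot x y + hdot x z"
  "hdot x (y - z) = hdot x y - hdot x z"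
  "hdot x (- y) = - hdot x y"
  "hdot x (c *s y) = c * hdot x y"
  by (simp_all add: hdot_def algebra_simps sum.distrib sum_subtractf sum_negf sum_distrib_left)

lemma comb_add: "comb v (x + y) = comb v x + comb v y"
  by (simp add: comb_def scaleC_simps sum.distrib)

lemma comb_scaleR: "comb v (r *\<^sub>R x) = r *\<^sub>R comb v x"
  unfolding comb_def scaleR_sum_right
  by (intro sum.cong refl l2_eqI) (simp add: scaleR_scaleC scaleR_conv_of_real[where 'a = complex])

lemma gram_mult: "(gram v w *v h) $ a = cip (v a) (comb w h)"
  by (simp add: gram_def comb_def matrix_vector_mult_def cip_sum_right cip_scaleC_right mult.commute)

lemma hdot_gram: "hdot h (gram v w *v g) = cip (comb v h) (comb w g)"
  by (simp add: hdot_def gram_mult comb_def[of v h] cip_sum_left cip_scaleC_left)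

lemma bounded_linear_comb: "bounded_linear (comb v)"
proof -
  have "linear (comb v)" by (rule linearI) (rule comb_add comb_scaleR)+
  then show ?thesis by (simp add: linear_conv_bounded_linear)
qed

text \<open>Later applied to \<open>HII \<phi>\<close> with \<open>\<phi>\<close> as the vector too,
  which is how a nonlinear interior block is covered.\<close>

lemma Im_hdot_hermitian:
  assumes "\<And>j k. H $ j $ k = cnj (H $ k $ j)"
  shows "Im (hdot x (H *v x)) = 0"
proof -
  have "cnj (hdot x (H *v x)) = (\<Sum>a\<in>UNIV. \<Sum>b\<in>UNIV. x $ a * (cnj (H $ a $ b) * cnj (x $ b)))"
    by (simp add: hdot_def matrix_vector_mult_def sum_distrib_left)
  also have "\<dots> = (\<Sum>b\<in>UNIV. \<Sum>a\<in>UNIV. x $ a * (cnj (H $ a $ b) * cnj (x $ b)))"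
    by (rule sum.swap)
  also have "\<dots> = hdot x (H *v x)"
    unfolding hdot_def matrix_vector_mult_def vec_lambda_beta sum_distrib_left
    by (intro sum.cong refl) (metis assms mult.commute mult.assoc)
  finally show ?thesis
    by (metis cnj.simps(2) equal_neg_zero)
qed

lemma hdot_transpose_real:
  assumes "\<And>a j. cnj (E $ a $ j) = E $ a $ j"
  shows "hdot x (transpose E *v f) = hdot (E *v x) f"
proof -
  have "hdot x (transpose E *v f) = (\<Sum>j\<in>UNIV. \<Sum>a\<in>UNIV. cnj (x $ j) * (E $ a $ j * f $ a))"
    by (simp only: hdot_def matrix_vector_mult_def vec_lambda_beta sum_distrib_left transpose_def)
  also have "\<dots> = (\<Sum>a\<in>UNIV. \<Sum>j\<in>UNIV. cnj (x $ j) * (E $ a $ j * f $ a))"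
    by (rule sum.swap)
  also have "\<dots> = hdot (E *v x) f"
    unfolding hdot_def matrix_vector_mult_def vec_lambda_beta cnj_sum sum_distrib_right
    by (intro sum.cong refl) (simp add: assms mult_ac)
  finally show ?thesis .
qed

context bounded_symmetric
begin

lemma M_sum: "M (\<Sum>a\<in>S. f a) = (\<Sum>a\<in>S. M (f a))"
proof -
  have "M 0 = 0" using M_diff[of 0 0] by simp
  then show ?thesis by (induction S rule: infinite_finite_induct) (auto simp: M_add)
qed

text \<open>
  With \<open>u = \<Sum> h\<^sub>a v\<^sub>a\<close>, \<open>f = Z g\<close> and \<open>x = \<Sum> g\<^sub>a X\<^sub>a\<close>, the left-hand side equals
  \<open>s(\<parallel>u\<parallel>\<^sup>2 - \<parallel>x\<parallel>\<^sup>2)\<close>; moreover \<open>\<langle>u, x\<rangle> = \<parallel>u\<parallel>\<^sup>2\<close>, that is, \<open>u\<close> is the orthogonal projection of \<open>x\<close>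
  onto the span of the \<open>v\<^sub>a\<close>.
\<close>
lemma dissipation:
  fixes v :: "'g::finite \<Rightarrow> 'e l2" and D :: "complex^'g^'g"
  assumes s: "s > 0"
    and X: "\<And>b. M (X b) - scaleC (\<i> * of_real s) (X b) = v b"
    and Z: "invertible (gram v X)"
    and D: "\<And>g. D *v (gram v X *v g) = \<i> *s (gram v v *v g)"
  shows "Re (hdot h (of_real s *s (gram v v *v h) - D *v (gram v v *v h))) \<le> 0"
proof -
  define f where "f = gram v v *v h"
  define g where "g = matrix_inv (gram v X) *v f"
  have f: "f = gram v X *v g"
    by (simp add: g_def matrix_vector_mul_assoc matrix_inv_right[OF Z])
  define u where "u = comb v h"
  define x where "x = comb X g"
  define y where "y = comb v g"
  have y: "M x - scaleC (\<i> * of_real s) x = y"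
  proof -
    have "M x - scaleC (\<i> * of_real s) x
        = (\<Sum>a\<in>UNIV. scaleC (g $ a) (M (X a) - scaleC (\<i> * of_real s) (X a)))"
      by (rule l2_eqI)
         (simp add: x_def comb_def M_sum M_scaleC sum_subtractf[symmetric] sum_distrib_left algebra_simps)
    then show ?thesis by (simp add: X y_def comb_def)
  qed
  have hf: "hdot h f = of_real ((norm u)\<^sup>2)"
    unfolding f_def hdot_gram by (simp add: cip_self u_def)
  have ux: "cip u x = of_real ((norm u)\<^sup>2)"
    using hf unfolding f hdot_gram by (simp add: u_def x_def)
  have "(norm u)\<^sup>2 \<le> norm u * norm x"
    using norm_cip_le[of u x] by (simp add: ux norm_power)
  then have "norm u \<le> norm x"
    by (cases "norm u = 0") (auto simp: power2_eq_square)
  then have le: "(norm u)\<^sup>2 \<le> (norm x)\<^sup>2" by simp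
  \<comment> \<open>Both \<open>gram v v *v h\<close> and \<open>gram v X *v g\<close> equal
    \<open>f\<close>; pairing them with \<open>g\<close> shows that \<open>u\<close> and
    \<open>x\<close> have the same product with \<open>y\<close>.\<close>
  have "cip y u = hdot g (gram v v *v h)"
    by (simp add: hdot_gram y_def u_def)
  also have "\<dots> = hdot g (gram v X *v g)"
    by (simp add: f_def[symmetric] f[symmetric])
  also have "\<dots> = cip y x"
    by (simp add: hdot_gram y_def x_def)
  finally have yu: "cip y u = cip y x" .
  \<comment> \<open>Here \<open>cip y x\<close> is the real number \<open>cip x (M x)\<close> plus
    \<open>\<i> s \<parallel>x\<parallel>\<^sup>2\<close>. It matters because the real part of
    \<open>\<i> * cnj z\<close> is \<open>Im z\<close>.\<close>
  have "Im (cip y x) = s * (norm x)\<^sup>2"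
    unfolding y[symmetric] cip_diff_left cip_scaleC_left M_sym cip_self by (simp add: Im_cip_M)
  moreover have "hdot h (D *v f) = \<i> * cnj (cip y u)"
    unfolding f D hdot_simps hdot_gram by (simp add: u_def y_def cip_commute[of "comb v h"])
  ultimately have "Re (hdot h (D *v f)) = s * (norm x)\<^sup>2"
    by (simp add: yu)
  then show ?thesis
    unfolding f_def[symmetric] hdot_simps hf using le s by simp
qed

text \<open>The Lyapunov function is realized as the squared norm of
  \<open>L (\<phi>, f) = (\<phi>, W f)\<close>. The coupling contributes \<open>Im w\<close> through
  the first component and \<open>- Im w\<close> through the second; \<open>dissipation\<close>
  bounds the rest.\<close>

lemma first_order_dynamics_stable:
  fixes v :: "'g::finite \<Rightarrow> 'e l2" and E :: "complex^'i^'g" and A B :: "complex^'g^'g"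
  assumes HII: "\<And>\<phi> j k. HII \<phi> $ j $ k = cnj (HII \<phi> $ k $ j)"
    and E: "\<And>a j. cnj (E $ a $ j) = E $ a $ j"
    and s: "s > 0"
    and X: "\<And>b. M (X b) - scaleC (\<i> * of_real s) (X b) = v b"
    and P: "invertible (gram v v)"
    and Z: "invertible (gram v X)"
    and A: "\<And>g. A *v g = - (\<i> *s (gram v v *v g))"
    and D: "\<And>g. (mat (of_real s) - B) *v (gram v X *v g) = \<i> *s (gram v v *v g)"
  shows "lyapunov_stable_zero (first_order_dynamics HII E A B)"
proof -
  define R where "R = matrix_inv (gram v v)"
  have PR: "gram v v *v (R *v f) = f" for f
    by (simp add: R_def matrix_vector_mul_assoc matrix_inv_right[OF P])
  define W where "W f = comb v (R *v f)" for f
  have W: "bounded_linear W"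
    unfolding W_def
    by (intro bounded_linear_compose[OF bounded_linear_comb] matrix_vector_mul_bounded_linear)
  define L where "L = (\<lambda>(\<phi>::complex^'i, f). (\<phi>, W f))"
  have L: "bounded_linear L"
    unfolding L_def case_prod_beta
    by (intro bounded_linear_Pair bounded_linear_fst bounded_linear_compose[OF W bounded_linear_snd])
  define c where "c = (\<Sum>a\<in>UNIV. norm (v a))"
  \<comment> \<open>Component \<open>a\<close> of \<open>f\<close> is
    \<open>cip (v a) (W f)\<close>, so Cauchy-Schwarz applies.\<close>
  have f_le: "norm f \<le> c * norm (W f)" for f
  proof -
    have "norm (f $ a) \<le> norm (v a) * norm (W f)" for a
      using norm_cip_le[of "v a" "W f"] gram_mult[of v v "R *v f" a] by (simp add: PR W_def)
    then have "(\<Sum>a\<in>UNIV. norm (f $ a)) \<le> c * norm (W f)"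
      unfolding c_def sum_distrib_right by (intro sum_mono)
    moreover have "norm f \<le> (\<Sum>a\<in>UNIV. norm (f $ a))"
      unfolding norm_vec_def by (rule L2_set_le_sum) simp
    ultimately show ?thesis by linarith
  qed
  have c: "c \<ge> 0" by (simp add: c_def sum_nonneg)
  show ?thesis
  proof (rule lyapunov_stable_zero_if_dissipative[OF L])
    show "first_order_dynamics HII E A B 0 = 0"
      by (simp add: first_order_dynamics_def zero_prod_def)
  next
    fix p :: "(complex^'i) \<times> (complex^'g)"
    obtain \<phi> f where p: "p = (\<phi>, f)" by fastforce
    have "norm p \<le> norm \<phi> + norm f"
      unfolding p by (rule norm_Pair_le)
    also have "\<dots> \<le> norm (L p) + c * norm (L p)"
    proof (rule add_mono)
      show "norm \<phi> \<le> norm (L p)"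
        using norm_fst_le[of \<phi> "W f"] by (simp add: p L_def)
      have "norm (W f) \<le> norm (L p)"
        using norm_snd_le[of "W f" \<phi>] by (simp add: p L_def)
      then show "norm f \<le> c * norm (L p)"
        using f_le[of f] c mult_left_mono order_trans by blast
    qed
    finally show "norm p \<le> (1 + c) * norm (L p)"
      by (simp add: distrib_right)
  next
    fix p :: "(complex^'i) \<times> (complex^'g)"
    obtain \<phi> f where p: "p = (\<phi>, f)" by fastforce
    define h where "h = R *v f"
    have f: "f = gram v v *v h" by (simp add: h_def PR)
    define F1 where "F1 = - (\<i> *s (HII \<phi> *v \<phi>)) - \<i> *s (transpose E *v f)"
    define F2 where "F2 = B *v f + A *v (E *v \<phi>)"
    define w where "w = hdot (E *v \<phi>) f"
    have "hdot \<phi> F1 = - \<i> * hdot \<phi> (HII \<phi> *v \<phi>) - \<i> * w"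
      unfolding F1_def hdot_simps hdot_transpose_real[OF E] w_def by simp
    then have 1: "inner \<phi> F1 = Im w"
      using Im_hdot_hermitian[of "HII \<phi>" \<phi>, OF HII] by (simp add: inner_eq_Re_hdot)
    have "mat (of_real s) *v f = of_real s *s f"
      by (simp add: matrix_vector_mult_def mat_def vec_eq_iff if_distrib if_distribR sum.delta cong: if_cong)
    \<comment> \<open>Writing \<open>B\<close> as \<open>s - (s - B)\<close> produces the expression
      in \<open>dissipation\<close>.\<close>
    then have "B *v f = of_real s *s f - (mat (of_real s) - B) *v f"
      by (simp add: matrix_vector_mult_diff_rdistrib)
    then have F2: "F2 = (of_real s *s (gram v v *v h) - (mat (of_real s) - B) *v (gram v v *v h))
        - \<i> *s (gram v v *v (E *v \<phi>))"
      unfolding F2_def A f[symmetric] by simp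
    have "hdot h (gram v v *v (E *v \<phi>)) = cnj (hdot (E *v \<phi>) (gram v v *v h))"
      unfolding hdot_gram by (rule cip_commute)
    then have hw: "hdot h (gram v v *v (E *v \<phi>)) = cnj w"
      by (simp add: w_def f)
    \<comment> \<open>Since \<open>R\<close> inverts the Gram matrix, the product in
      \<open>\<ell>\<^sup>2\<close> becomes the plain pairing of \<open>h\<close> with
      \<open>F2\<close>.\<close>
    have "inner (W f) (W F2) = Re (hdot h F2)"
      unfolding inner_l2 W_def hdot_gram[symmetric] PR h_def ..
    also have "\<dots> = Re (hdot h (of_real s *s (gram v v *v h) - (mat (of_real s) - B) *v (gram v v *v h)))
        - Re (\<i> * cnj w)"
      by (subst F2) (simp only: hdot_simps(2)[of h _ "\<i> *s _"] hdot_simps(4)[of h \<i>] hw minus_complex.simps)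
    also have "\<dots> \<le> - Im w"
      using dissipation[OF s X Z D, of h] by simp
    finally have "inner \<phi> F1 + inner (W f) (W F2) \<le> 0"
      using 1 by simp
    then show "inner (L p) (L (first_order_dynamics HII E A B p)) \<le> 0"
      by (simp add: p L_def first_order_dynamics_def F1_def F2_def)
  qed
qed

end

section \<open>From the interpolation conditions to the Gram matrix relations\<close>

theorem mainTheorem2:
  fixes HII :: "complex^'i \<Rightarrow> complex^'i^'i"
    and HIE :: "'i \<Rightarrow> 'e \<Rightarrow> complex"
    and HEI :: "'e \<Rightarrow> 'i \<Rightarrow> complex"
    and HEE :: "'e \<Rightarrow> 'e \<Rightarrow> complex"
    and \<iota> :: "'g::finite \<Rightarrow> 'i::finite"
    and A B :: "complex^'g^'g"
    and s\<^sub>1 :: real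
  assumes "hermitian_blocks HII HIE HEI HEE"
    and "bounded_on_ell2 HEE"
    and "\<And>j. HIE j \<in> ell2"
    and "bij_betw \<iota> UNIV (boundary_set HIE)"
    and "s\<^sub>1 > 0"
    and "determined_by_interpolation (DtN \<iota> HIE HEI HEE) s\<^sub>1 A B"
  shows "lyapunov_stable_zero (first_order_dynamics HII (restriction \<iota>) A B)"
proof -
  let ?K = "DtN \<iota> HIE HEI HEE"
  have HII: "\<And>\<phi> j k. HII \<phi> $ j $ k = cnj (HII \<phi> $ k $ j)"
    and HIE: "\<And>j k. HIE j k = cnj (HEI k j)" and HEE: "\<And>j k. HEE j k = cnj (HEE k j)"
    using assms(1) unfolding hermitian_blocks_def by blast+
  obtain C where "bounded_symmetric (op_l2 HEE) C"
    using bounded_symmetric_op_l2[OF assms(2) HEE] by blast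
  then interpret bounded_symmetric "op_l2 HEE" C .
  define v where "v b = Abs_l2 (\<lambda>l. HEI l (\<iota> b))" for b
  have HEI: "(\<lambda>l. HEI l j) \<in> ell2" for j
    using ell2_cnj[OF assms(3)[of j]] by (simp add: HIE)
  have v: "coord (v b) = (\<lambda>l. HEI l (\<iota> b))" for b
    unfolding v_def by (rule Abs_l2_inverse[OF HEI])
  have K: "?K s $ a $ b = - cip (v a) (resolv s (v b))" if "Re s > 0" for s a b
  proof -
    have "resolvent_apply HEE (\<i> * s) (\<lambda>l. HEI l (\<iota> b)) = coord (resolv s (v b))"
      using resolvent_apply_eq[OF refl assms(2) that, of "v b"] by (simp add: v)
    then show ?thesis
      by (simp add: DtN_def cip_def v HIE)
  qed
  define X where "X b = resolv (of_real s\<^sub>1) (v b)" for b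
  have X: "op_l2 HEE (X b) - scaleC (\<i> * of_real s\<^sub>1) (X b) = v b" for b
    unfolding X_def using assms(5) by (intro resolv_eq) simp
  have KZ: "?K (of_real s\<^sub>1) = - gram v X"
    using assms(5) by (simp add: vec_eq_iff K gram_def X_def)
  define D where "D = mat (of_real s\<^sub>1) - B"
  have int: "interpolates ?K s\<^sub>1 A B"
    and unique: "\<And>A' B'. interpolates ?K s\<^sub>1 A' B' \<Longrightarrow> A' = A \<and> B' = B"
    using assms(6) unfolding determined_by_interpolation_def by blast+
  obtain l where l: "(matrix_deriv (\<lambda>z. R11 A B (inverse z)) \<longlongrightarrow> l) (at 0)"
      "(matrix_deriv (\<lambda>z. ?K (inverse z)) \<longlongrightarrow> l) (at 0)"
    and D: "invertible D" and R: "R11 A B (of_real s\<^sub>1) = ?K (of_real s\<^sub>1)"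
    using int unfolding interpolates_def D_def by blast
  have lA: "l = A"
    using tendsto_unique[OF _ l(1) R11_deriv_tendsto] by simp
  have A: "A $ a $ b = - \<i> * cip (v a) (v b)" for a b
  proof (rule deriv_resolv_tendsto_unique)
    show "?K s $ a $ b = - cip (v a) (resolv s (v b))" if "Re s > 0" for s
      by (rule K[OF that])
    have "((\<lambda>z. matrix_deriv (\<lambda>z. ?K (inverse z)) z $ a $ b) \<longlongrightarrow> A $ a $ b) (at 0)"
      using l(2) unfolding lA by (intro tendsto_vec_nth)
    then show "(deriv (\<lambda>z. ?K (inverse z) $ a $ b) \<longlongrightarrow> A $ a $ b) (at 0)"
      by (simp add: matrix_deriv_def)
  qed
  have DK: "D ** ?K (of_real s\<^sub>1) = A"
    unfolding R[symmetric] R11_def D_def[symmetric]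
    by (simp add: matrix_mul_assoc matrix_inv_right[OF D])
  \<comment> \<open>Uniqueness enters here: were this value singular, another invertible factor
    \<open>D'\<close> would give the same product \<open>A\<close>, and \<open>B'\<close> would
    solve the interpolation conditions as well.\<close>
  have invK: "invertible (?K (of_real s\<^sub>1))"
  proof (rule ccontr)
    assume "\<not> invertible (?K (of_real s\<^sub>1))"
    then obtain D' where D': "invertible D'" "D' ** ?K (of_real s\<^sub>1) = D ** ?K (of_real s\<^sub>1)" "D' \<noteq> D"
      using invertible_factor_not_unique[OF D] by blast
    define B' where "B' = mat (of_real s\<^sub>1) - D'"
    have D'_eq: "mat (of_real s\<^sub>1) - B' = D'" by (simp add: B'_def)
    have "R11 A B' (of_real s\<^sub>1) = ?K (of_real s\<^sub>1)"
      unfolding R11_def D'_eq DK[symmetric] D'(2)[symmetric]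
      by (simp add: matrix_mul_assoc matrix_inv_left[OF D'(1)])
    then have "interpolates ?K s\<^sub>1 A B'"
      unfolding interpolates_def D'_eq using R11_deriv_tendsto l(2) D'(1) lA by blast
    then have "B' = B" using unique by blast
    then show False using D'(3) by (simp add: D'_eq[symmetric] D_def)
  qed
  have Z: "invertible (gram v X)"
  proof (rule invertible_scaled[OF invK])
    show "gram v X *v g = (-1) *s (?K (of_real s\<^sub>1) *v g)" for g
      by (simp add: KZ vec_eq_iff matrix_vector_mult_def sum_negf)
  qed simp
  have Av: "A *v g = - (\<i> *s (gram v v *v g))" for g
    by (simp add: vec_eq_iff matrix_vector_mult_def A gram_def sum_distrib_left sum_negf mult_ac)
  have Dv: "D *v (gram v X *v g) = \<i> *s (gram v v *v g)" for g
  proof -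
    have "D *v (?K (of_real s\<^sub>1) *v g) = A *v g"
      by (simp add: matrix_vector_mul_assoc DK)
    moreover have "?K (of_real s\<^sub>1) *v g = - (gram v X *v g)"
      by (simp add: KZ vec_eq_iff matrix_vector_mult_def sum_negf)
    moreover have "D *v (- (gram v X *v g)) = - (D *v (gram v X *v g))"
      by (simp add: vec_eq_iff matrix_vector_mult_def sum_negf)
    ultimately show ?thesis unfolding Av by simp
  qed
  \<comment> \<open>\<open>A\<close> is the product of the invertible matrices \<open>D\<close> and
    \<open>K(s\<^sub>1)\<close>, and the Gram matrix is \<open>\<i>\<close> times
    \<open>A\<close>.\<close>
  have P: "invertible (gram v v)"
  proof (rule invertible_scaled)
    show "invertible A" using invertible_mult[OF D invK] by (simp add: DK)
    show "gram v v *v g = \<i> *s (A *v g)" for g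
      by (simp add: Av vec_eq_iff)
  qed simp
  show ?thesis
    by (rule first_order_dynamics_stable[OF HII _ assms(5) X P Z Av Dv[unfolded D_def]])
       (simp add: restriction_def)
qed

end
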